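(* Let $\varphi\in\mathcal{S}$ be not identically zero, with canonical factorization $\varphi=\alpha z^N B S F$. Suppose that $\varphi$ satisfies at least one of the following three conditions: (C1) $N\ge 2$; (C2) the Blaschke factor $B$ is nontrivial; (C3) the singular inner factor $S$ is nontrivial. Then, for every $t>0$, the kernel $$k_t(z,\lambda)=\exp\left(t\,\frac{1-\overline{\varphi(\lambda)}\varphi(z)}{1-\overline{\lambda}z}\right)\qquad (z,\lambda\in\mathbb{D})$$ is strictly positive definite on $\mathbb{D}$.
   Context: $\mathbb{D}$ is the open unit disk in $\mathbb{C}$; $H^\infty$ is the algebra of bounded analytic functions on $\mathbb{D}$; the Schur class is $\mathcal{S}=\{\varphi\in H^\infty: |\varphi(\lambda)|\le 1 \text{ for all } \lambda\in\mathbb{D}\}$. Canonical factorization: every $\varphi\in\mathcal{S}$ that is not identically zero factors as $\varphi=\alpha z^N B S F$, where $\alpha$ is a unimodular constant, $N\ge 0$ is the order of the zero of $\varphi$ at $0$, $B$ is the Blaschke product formed from the nonzero zeros of $\varphi$ (with multiplicity), $S$ is a singular inner function, and $F$ is an outer function. "$B$ is nontrivial" means that $\varphi$ has at least one zero in $\mathbb{D}\setminus\{0\}$; "$S$ is nontrivial" means that $S$ is nonconstant. A function $k:X\times X\to\mathbb{C}$ on a set $X$ is a strictly positive definite kernel on $X$ if $k(x,y)=\overline{k(y,x)}$ for all $x,y\in X$ and $\sum_{i,j=1}^n c_i\overline{c_j}\,k(x_j,x_i)>0$ for every $n\in\mathbb{N}$, every $(c_1,\dots,c_n)\in\mathbb{C}^n\setminus\{\mathbf{0}\}$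 and every choice of $n$ distinct points $x_1,\dots,x_n\in X$. *)

theory Defs
  imports "HOL-Complex_Analysis.Complex_Analysis" "HOL-Probability.Probability"
begin

abbreviation unit_disk :: "complex set" where
  "unit_disk \<equiv> ball 0 1"

definition Schur_class :: "(complex \<Rightarrow> complex) set" where
  "Schur_class = {\<phi>. \<phi> holomorphic_on unit_disk \<and> (\<forall>z\<in>unit_disk. norm (\<phi> z) \<le> 1)}"

definition arc_measure :: "complex measure" where
  "arc_measure =
     distr (uniform_measure lborel {0..2 * pi}) (restrict_space borel (sphere 0 1)) cis"

definition blaschke_factor :: "complex \<Rightarrow> complex \<Rightarrow> complex" where
  "blaschke_factor a z = of_real (norm a) / a * ((a - z) / (1 - cnj a * z))"

(* The possibly infinite product is the limit of the net of its finite subproducts.  It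
   converges absolutely on the disk for a nonzero bounded analytic function, so every
   enumeration of the zeros gives the same value. *)
definition is_blaschke_product_of ::
    "(complex \<Rightarrow> complex) \<Rightarrow> (complex \<Rightarrow> complex) \<Rightarrow> bool" where
  "is_blaschke_product_of \<phi> B \<longleftrightarrow>
     (\<forall>z\<in>unit_disk.
        ((\<lambda>A. \<Prod>a\<in>A. blaschke_factor a z ^ nat (zorder \<phi> a)) \<longlongrightarrow> B z)
          (finite_subsets_at_top {a \<in> unit_disk. a \<noteq> 0 \<and> \<phi> a = 0}))"

definition mutually_singular :: "'a measure \<Rightarrow> 'a measure \<Rightarrow> bool" where
  "mutually_singular \<mu> \<nu> \<longleftrightarrow>
     sets \<mu> = sets \<nu> \<and> (\<exists>A. A \<in> null_sets \<nu> \<and> space \<mu> - A \<in> null_sets \<mu>)"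

(* The zero measure is allowed, so the constant 1 is the trivial singular inner function. *)
definition singular_inner :: "(complex \<Rightarrow> complex) \<Rightarrow> bool" where
  "singular_inner S \<longleftrightarrow>
     (\<exists>\<mu>. finite_measure \<mu> \<and> mutually_singular \<mu> arc_measure \<and>
        (\<forall>z\<in>unit_disk. S z = exp (- (LINT \<zeta>|\<mu>. (\<zeta> + z) / (\<zeta> - z)))))"

definition outer_function :: "(complex \<Rightarrow> complex) \<Rightarrow> bool" where
  "outer_function F \<longleftrightarrow>
     (\<exists>c \<psi>. norm c = 1 \<and>
        \<psi> \<in> borel_measurable arc_measure \<and> (\<forall>\<zeta>\<in>sphere 0 1. 0 < \<psi> \<zeta>) \<and>
        integrable arc_measure (\<lambda>\<zeta>. ln (\<psi> \<zeta>)) \<and>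
        (\<forall>z\<in>unit_disk.
           F z = c * exp (LINT \<zeta>|arc_measure. (\<zeta> + z) / (\<zeta> - z) * complex_of_real (ln (\<psi> \<zeta>)))))"

(* For holomorphic \<phi> that is not identically zero on the disk, zorder \<phi> 0 is the order of
   the zero at 0, and is 0 if \<phi> 0 \<noteq> 0. *)
definition canonical_factorization ::
    "(complex \<Rightarrow> complex) \<Rightarrow> complex \<Rightarrow> nat \<Rightarrow> (complex \<Rightarrow> complex) \<Rightarrow>
     (complex \<Rightarrow> complex) \<Rightarrow> (complex \<Rightarrow> complex) \<Rightarrow> bool" where
  "canonical_factorization \<phi> \<alpha> N B S F \<longleftrightarrow>
     norm \<alpha> = 1 \<and> int N = zorder \<phi> 0 \<and> is_blaschke_product_of \<phi> B \<and>
     singular_inner S \<and> outer_function F \<and>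
     (\<forall>z\<in>unit_disk. \<phi> z = \<alpha> * z ^ N * B z * S z * F z)"

definition strictly_positive_definite_on :: "'a set \<Rightarrow> ('a \<Rightarrow> 'a \<Rightarrow> complex) \<Rightarrow> bool" where
  "strictly_positive_definite_on X k \<longleftrightarrow>
     (\<forall>x\<in>X. \<forall>y\<in>X. k x y = cnj (k y x)) \<and>
     (\<forall>(n::nat) (c :: nat \<Rightarrow> complex) x.
        (\<forall>i<n. x i \<in> X) \<and> inj_on x {..<n} \<and> (\<exists>i<n. c i \<noteq> 0) \<longrightarrow>
        (let s = (\<Sum>i<n. \<Sum>j<n. c i * cnj (c j) * k (x j) (x i)) in s \<in> \<real> \<and> Re s > 0))"

end

theory Submission imports Defs begin

text \<open>
Write \<open>K z l = (1 - cnj (\<phi> l) * \<phi> z) / (1 - cnj l * z)\<close> for the de Branges-Rovnyak kernel of \<open>\<phi>\<close>. It is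
positive semidefinite (\<open>de_branges_rovnyak_kernel_psd\<close>), because multiplication by \<open>\<phi>\<close> is a contraction
of the Hardy space.

For a positive semidefinite kernel \<open>k\<close>, the exponential of \<open>t * k\<close> with \<open>t > 0\<close> is strictly positive
definite as soon as the functions \<open>k _ a\<close> are pairwise distinct
(\<open>exp_kernel_strictly_positive_definite\<close>). Indeed \<open>k z l\<close> is, on a finite set, the inner product of Gram
vectors, and the power \<open>k ^ m\<close> belongs to their tensor powers. A combination of exponentials of form zero
therefore annihilates all polynomials in the Gram vectors, and polynomials interpolate arbitrary
values at distinct vectors.

It remains to exclude that two kernel functions of \<open>K\<close> at distinct points agree. Solving \<open>K z a = K z b\<close>
for \<open>\<phi> z\<close> shows that \<open>\<phi> z = z / (p + q * z)\<close> off 0, and since \<open>\<phi>\<close> is bounded by 1, either \<open>\<phi>\<close> is constant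
there or the pole lies outside the closed disk. So the zero at 0 has order at most 1, there are no
other zeros, and up to a constant factor \<open>S * F\<close> is 1 or \<open>1 / (p + q * z)\<close>, which has a holomorphic
logarithm near the closed disk. Such a function has no singular factor
(\<open>singular_factor_of_regular_function_trivial\<close>): by the Schwarz formula such a
logarithm is, up to an imaginary constant, the Herglotz integral of a continuous density, Herglotz integrals determine the underlying
measure, and a singular measure that has a density is zero. This contradicts each of the three conditions.
\<close>

section \<open>Positive semidefinite kernels and Gram vectors\<close>

text \<open>The order of the arguments of \<open>k\<close> is that of the sums in the definition of strict positive
definiteness: for a kernel of the form \<open>k z l = \<langle>k_l, k_z\<rangle>\<close> the value is the squared norm of
\<open>\<Sum>x\<in>A. c x * k_x\<close>.\<close>

definition hermitian_form :: "'a set \<Rightarrow> ('a \<Rightarrow> 'a \<Rightarrow> complex) \<Rightarrow> ('a \<Rightarrow> complex) \<Rightarrow> complex" where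
  "hermitian_form A k c = (\<Sum>x\<in>A. \<Sum>y\<in>A. c x * cnj (c y) * k y x)"

definition positive_semidefinite_on :: "'a set \<Rightarrow> ('a \<Rightarrow> 'a \<Rightarrow> complex) \<Rightarrow> bool" where
  "positive_semidefinite_on X k \<longleftrightarrow>
     (\<forall>x\<in>X. \<forall>y\<in>X. k x y = cnj (k y x)) \<and>
     (\<forall>A c. finite A \<and> A \<subseteq> X \<longrightarrow> 0 \<le> Re (hermitian_form A k c))"

lemma psd_hermitian: "positive_semidefinite_on X k \<Longrightarrow> x \<in> X \<Longrightarrow> y \<in> X \<Longrightarrow> k x y = cnj (k y x)"
  unfolding positive_semidefinite_on_def by blast

lemma psd_form_nonneg:
  "positive_semidefinite_on X k \<Longrightarrow> finite A \<Longrightarrow> A \<subseteq> X \<Longrightarrow> 0 \<le> Re (hermitian_form A k c)"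
  unfolding positive_semidefinite_on_def by blast

lemma psd_subset: "positive_semidefinite_on X k \<Longrightarrow> Y \<subseteq> X \<Longrightarrow> positive_semidefinite_on Y k"
  unfolding positive_semidefinite_on_def by blast

lemma psd_cong:
  assumes "\<And>x y. x \<in> X \<Longrightarrow> y \<in> X \<Longrightarrow> k x y = k' x y"
  shows "positive_semidefinite_on X k \<longleftrightarrow> positive_semidefinite_on X k'"
proof -
  have "hermitian_form A k c = hermitian_form A k' c" if "A \<subseteq> X" for A c
    unfolding hermitian_form_def using that by (intro sum.cong) (auto simp: assms subsetD)
  then show ?thesis
    using assms unfolding positive_semidefinite_on_def by auto
qed

lemma hermitian_form_insert:
  assumes "finite A" "a \<notin> A"
  shows "hermitian_form (insert a A) k c = hermitian_form A k c + c a * cnj (c a) * k a a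
     + c a * (\<Sum>y\<in>A. cnj (c y) * k y a) + cnj (c a) * (\<Sum>x\<in>A. c x * k a x)"
  using assms by (simp add: hermitian_form_def sum.distrib sum_distrib_left algebra_simps)

lemma psd_diagonal:
  assumes "positive_semidefinite_on X k" "a \<in> X"
  shows "k a a = of_real (Re (k a a))" "0 \<le> Re (k a a)"
proof -
  have "k a a = cnj (k a a)"
    using assms by (intro psd_hermitian)
  then show "k a a = of_real (Re (k a a))"
    by (metis Reals_cnj_iff of_real_Re)
  have "0 \<le> Re (hermitian_form {a} k (\<lambda>_. 1))"
    by (rule psd_form_nonneg[OF assms(1)]) (use assms in auto)
  then show "0 \<le> Re (k a a)" by (simp add: hermitian_form_def)
qed

text \<open>The Cauchy-Schwarz inequality \<open>\<bar>k a b\<bar>\<^sup>2 \<le> k a a * k b b\<close> in the degenerate case: if \<open>k a b \<noteq> 0\<close>, a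
large multiple of \<open>a\<close> makes the cross term dominate the form on \<open>{a, b}\<close> and turns it negative.\<close>

lemma psd_zero_diagonal:
  assumes psd: "positive_semidefinite_on X k" and "a \<in> X" "b \<in> X" and 0: "k a a = 0"
  shows "k a b = 0" "k b a = 0"
proof -
  have h: "k b a = cnj (k a b)"
    using psd assms(2,3) by (intro psd_hermitian)
  show "k a b = 0"
  proof (rule ccontr)
    assume nz: "k a b \<noteq> 0"
    then have "a \<noteq> b" using 0 by auto
    \<comment> \<open>This weight makes the cross term equal to minus twice \<open>k b b + 1\<close>.\<close>
    define r where "r = (Re (k b b) + 1) / (norm (k a b))\<^sup>2"
    define c where "c = (\<lambda>x. if x = a then - of_real r * k a b else 1 :: complex)"
    have nn: "k a b * cnj (k a b) = of_real ((norm (k a b))\<^sup>2)"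
      by (metis complex_norm_square)
    have "hermitian_form {a, b} k c = k b b - 2 * of_real r * (k a b * cnj (k a b))"
      using \<open>a \<noteq> b\<close> 0 h by (simp add: hermitian_form_def c_def algebra_simps)
    also have "\<dots> = k b b - 2 * of_real (r * (norm (k a b))\<^sup>2)"
      unfolding nn by simp
    also have "r * (norm (k a b))\<^sup>2 = Re (k b b) + 1" using nz by (simp add: r_def)
    finally have "Re (hermitian_form {a, b} k c) = Re (k b b) - 2 * (Re (k b b) + 1)" by simp
    moreover have "0 \<le> Re (hermitian_form {a, b} k c)"
      by (rule psd_form_nonneg[OF psd]) (use assms in auto)
    ultimately show False using psd_diagonal(2)[OF psd \<open>b \<in> X\<close>] by argo
  qed
  then show "k b a = 0" using h by simp
qed

text \<open>One step of Gaussian elimination. The form of the Schur complement at \<open>c\<close> is the minimum of the form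
of \<open>k\<close> over all values of the coefficient at \<open>a\<close>, hence nonnegative.\<close>

lemma psd_schur_complement:
  assumes psd: "positive_semidefinite_on (insert a A) k" and "finite A" "a \<notin> A" and nz: "k a a \<noteq> 0"
  shows "positive_semidefinite_on A (\<lambda>x y. k x y - k x a * k a y / k a a)"
    (is "positive_semidefinite_on A ?k")
  unfolding positive_semidefinite_on_def
proof (intro conjI ballI allI impI)
  have herm: "k x y = cnj (k y x)" if "x \<in> insert a A" "y \<in> insert a A" for x y
    using psd that by (rule psd_hermitian)
  have aa: "cnj (k a a) = k a a" using herm by (metis insertI1)
  fix x y assume "x \<in> A" "y \<in> A"
  then show "?k x y = cnj (?k y x)"
    using herm[of x y] herm[of a x] herm[of a y] aa by (simp add: mult.commute)
next
  fix D c assume D: "finite D \<and> D \<subseteq> A"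
  have herm: "k x y = cnj (k y x)" if "x \<in> insert a A" "y \<in> insert a A" for x y
    using psd that by (rule psd_hermitian)
  have aa: "cnj (k a a) = k a a" using herm by (metis insertI1)
  have a: "a \<notin> D" "finite D" using D assms by auto
  define s where "s = (\<Sum>x\<in>D. c x * k a x)"
  have s': "(\<Sum>y\<in>D. cnj (c y) * k y a) = cnj s"
    unfolding s_def cnj_sum using D by (intro sum.cong) (auto simp: herm[of _ a])
  \<comment> \<open>The coefficient at \<open>a\<close> that minimises the form.\<close>
  define e where "e = c(a := - s / k a a)"
  have e: "e x = c x" if "x \<in> D" for x using a that by (auto simp: e_def)
  have 1: "hermitian_form D k e = hermitian_form D k c"
    "(\<Sum>y\<in>D. cnj (e y) * k y a) = cnj s" "(\<Sum>x\<in>D. e x * k a x) = s"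
    by (auto simp: hermitian_form_def e s' s_def cong: sum.cong)
  have "hermitian_form (insert a D) k e
      = hermitian_form D k c + e a * cnj (e a) * k a a + e a * cnj s + cnj (e a) * s"
    using hermitian_form_insert[OF a(2,1), of k e] unfolding 1 .
  also have "\<dots> = hermitian_form D k c - s * cnj s / k a a"
    using nz aa by (simp add: e_def field_simps)
  also have "s * cnj s = (\<Sum>x\<in>D. \<Sum>y\<in>D. c x * k a x * (cnj (c y) * k y a))"
    unfolding s'[symmetric] unfolding s_def by (rule sum_product)
  also have "hermitian_form D k c - \<dots> / k a a = hermitian_form D ?k c"
    unfolding hermitian_form_def
    by (simp add: sum_divide_distrib sum_subtractf[symmetric] algebra_simps)
  finally have "hermitian_form D ?k c = hermitian_form (insert a D) k e" ..
  moreover have "finite (insert a D) \<and> insert a D \<subseteq> insert a A" using D by auto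
  then have "0 \<le> Re (hermitian_form (insert a D) k e)"
    using psd_form_nonneg[OF psd] by blast
  ultimately show "0 \<le> Re (hermitian_form D ?k c)" by (simp only:)
qed

text \<open>The Cholesky factorisation: subtract the rank one kernel that carries row and column \<open>a\<close>, and
factor the Schur complement by induction. Each point of \<open>A\<close> contributes one coordinate, so the
coordinates of the Gram vectors can be indexed by \<open>A\<close> itself.\<close>

lemma psd_gram_vectors:
  assumes "finite A" "positive_semidefinite_on A k"
  shows "\<exists>w :: 'a \<Rightarrow> 'a \<Rightarrow> complex. \<forall>x\<in>A. \<forall>y\<in>A. k y x = (\<Sum>u\<in>A. w u x * cnj (w u y))"
  using assms
proof (induction A arbitrary: k)
  case empty
  then show ?case by simp
next
  case (insert a A)
  have herm: "k x y = cnj (k y x)" if "x \<in> insert a A" "y \<in> insert a A" for x y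
    using insert.prems that by (rule psd_hermitian)
  define r where "r = Re (k a a)"
  have r: "k a a = of_real r" "0 \<le> r"
    using psd_diagonal[OF insert.prems] by (auto simp: r_def)
  \<comment> \<open>If the pivot is zero, this is the zero function because \<open>x / 0 = 0\<close>, and row and column
    \<open>a\<close> of the kernel vanish as well.\<close>
  define l where "l = (\<lambda>x. k a x / of_real (sqrt r))"
  define k' where "k' = (\<lambda>x y. k x y - cnj (l x) * l y)"
  have sq: "of_real (sqrt r) * of_real (sqrt r) = (of_real r :: complex)"
    using r(2) by (metis of_real_mult real_sqrt_mult_self abs_of_nonneg)
  have l0: "l = (\<lambda>x. 0)" if "r = 0" using that by (simp add: l_def)
  have psd': "positive_semidefinite_on A k'"
  proof (cases "r = 0")
    case True
    then show ?thesis using psd_subset[OF insert.prems] l0 by (auto simp: k'_def)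
  next
    case False
    have "positive_semidefinite_on A (\<lambda>x y. k x y - k x a * k a y / k a a)"
      by (rule psd_schur_complement) (use insert False r in auto)
    moreover have "k' x y = k x y - k x a * k a y / k a a" if "x \<in> A" for x y
      using herm[of x a] that by (simp add: k'_def l_def r(1) sq[symmetric])
    ultimately show ?thesis
      using psd_cong[of A k' "\<lambda>x y. k x y - k x a * k a y / k a a"] by blast
  qed
  have ka: "k x y = cnj (l x) * l y" if "x \<in> insert a A" "y \<in> insert a A" "x = a \<or> y = a" for x y
  proof (cases "r = 0")
    case True
    then have "k a a = 0" using r(1) by simp
    then have "k x y = 0"
      using psd_zero_diagonal[OF insert.prems insertI1, of y] psd_zero_diagonal[OF insert.prems insertI1, of x]
        that by metis
    then show ?thesis using l0[OF True] by simp
  next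
    case False
    then have nz: "complex_of_real (sqrt r) \<noteq> 0" using r by simp
    have aa: "k a a / complex_of_real (sqrt r) = of_real (sqrt r)"
      unfolding r(1) sq[symmetric] using nz by (rule nonzero_mult_div_cancel_left)
    show ?thesis using that(3)
    proof
      assume "x = a"
      then show ?thesis using nz unfolding l_def by (simp add: aa)
    next
      assume "y = a"
      moreover have "k x a = cnj (k a x)" using herm that by blast
      ultimately show ?thesis using nz unfolding l_def by (simp add: aa)
    qed
  qed
  obtain w where w: "\<forall>x\<in>A. \<forall>y\<in>A. k' y x = (\<Sum>u\<in>A. w u x * cnj (w u y))"
    using insert.IH[OF psd'] by blast
  define v where "v = (\<lambda>u x. if u = a then l x else if x = a then 0 else w u x)"
  have "k y x = (\<Sum>u\<in>insert a A. v u x * cnj (v u y))" if "x \<in> insert a A" "y \<in> insert a A" for x y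
  proof -
    have "(\<Sum>u\<in>insert a A. v u x * cnj (v u y)) = l x * cnj (l y) + (\<Sum>u\<in>A. v u x * cnj (v u y))"
      using insert.hyps by (simp add: v_def)
    also have "(\<Sum>u\<in>A. v u x * cnj (v u y)) =
        (if x = a \<or> y = a then 0 else (\<Sum>u\<in>A. w u x * cnj (w u y)))"
      using insert.hyps by (auto simp: v_def intro!: sum.cong sum.neutral)
    also have "l x * cnj (l y) + \<dots> = k y x"
    proof (cases "x = a \<or> y = a")
      case True
      then show ?thesis using ka[of y x] that by (auto simp: mult.commute)
    next
      case False
      then have "k' y x = (\<Sum>u\<in>A. w u x * cnj (w u y))" using w that by blast
      then show ?thesis using False by (simp add: k'_def algebra_simps)
    qed
    finally show ?thesis ..
  qed
  then show ?case by (intro exI[of _ v]) simp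
qed

section \<open>Exponentials of positive semidefinite kernels\<close>

text \<open>This is the tensor power trick in coordinates: passing from the Gram vectors of \<open>k ^ m\<close> to those of
\<open>k ^ Suc m\<close> multiplies the coefficients by one more coordinate of the Gram vectors of \<open>k\<close>. It proves
the nonnegativity of all powers (a case of the Schur product theorem) and at the same time identifies
the coefficients on which the forms of all powers vanish.\<close>

lemma hermitian_form_power_gram:
  assumes gram: "\<And>x y. x \<in> A \<Longrightarrow> y \<in> A \<Longrightarrow> k y x = (\<Sum>u\<in>U. w u x * cnj (w u y))"
  shows "hermitian_form A (\<lambda>x y. k x y ^ Suc m) c
       = (\<Sum>u\<in>U. hermitian_form A (\<lambda>x y. k x y ^ m) (\<lambda>x. c x * w u x))"
proof -
  have "hermitian_form A (\<lambda>x y. k x y ^ Suc m) c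
      = (\<Sum>x\<in>A. \<Sum>y\<in>A. \<Sum>u\<in>U. c x * w u x * cnj (c y * w u y) * k y x ^ m)"
    unfolding hermitian_form_def
    by (intro sum.cong refl) (simp add: gram sum_distrib_left sum_distrib_right mult_ac)
  also have "\<dots> = (\<Sum>x\<in>A. \<Sum>u\<in>U. \<Sum>y\<in>A. c x * w u x * cnj (c y * w u y) * k y x ^ m)"
    by (intro sum.cong refl sum.swap)
  also have "\<dots> = (\<Sum>u\<in>U. \<Sum>x\<in>A. \<Sum>y\<in>A. c x * w u x * cnj (c y * w u y) * k y x ^ m)"
    by (rule sum.swap)
  finally show ?thesis by (simp add: hermitian_form_def)
qed

lemma hermitian_form_one: "hermitian_form A (\<lambda>x y. 1) c = of_real ((norm (sum c A))\<^sup>2)"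
  unfolding complex_norm_square by (simp add: hermitian_form_def sum_product)

lemma hermitian_form_power_nonneg:
  assumes gram: "\<And>x y. x \<in> A \<Longrightarrow> y \<in> A \<Longrightarrow> k y x = (\<Sum>u\<in>U. w u x * cnj (w u y))"
  shows "Im (hermitian_form A (\<lambda>x y. k x y ^ m) c) = 0 \<and> 0 \<le> Re (hermitian_form A (\<lambda>x y. k x y ^ m) c)"
proof (induction m arbitrary: c)
  case 0
  show ?case unfolding power_0 hermitian_form_one by simp
next
  case (Suc m)
  have "hermitian_form A (\<lambda>x y. k x y ^ Suc m) c
      = (\<Sum>u\<in>U. hermitian_form A (\<lambda>x y. k x y ^ m) (\<lambda>x. c x * w u x))"
    by (rule hermitian_form_power_gram[OF gram])
  then show ?case
    unfolding Im_sum Re_sum using Suc by (simp add: sum_nonneg del: power_Suc)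
qed

text \<open>A nonnegative sum vanishes only termwise, so the coefficients annihilated by the forms of all powers
are closed under multiplication by each coordinate \<open>w u\<close>. Such coefficients therefore annihilate
every monomial in the coordinates.\<close>

lemma hermitian_form_power_zero_words:
  assumes gram: "\<And>x y. x \<in> A \<Longrightarrow> y \<in> A \<Longrightarrow> k y x = (\<Sum>u\<in>U. w u x * cnj (w u y))"
    and "finite U" "\<And>m. hermitian_form A (\<lambda>x y. k x y ^ m) c = 0" "set us \<subseteq> U"
  shows "(\<Sum>x\<in>A. c x * (\<Prod>u\<leftarrow>us. w u x)) = 0"
  using assms(3,4)
proof (induction us arbitrary: c)
  case Nil
  then have "hermitian_form A (\<lambda>x y. k x y ^ 0) c = 0" by blast
  then show ?case unfolding power_0 hermitian_form_one by simp
next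
  case (Cons u us)
  have "hermitian_form A (\<lambda>x y. k x y ^ m) (\<lambda>x. c x * w u x) = 0" for m
  proof -
    define f where "f = (\<lambda>u. hermitian_form A (\<lambda>x y. k x y ^ m) (\<lambda>x. c x * w u x))"
    have "(\<Sum>u\<in>U. f u) = 0"
      using Cons.prems(1)[of "Suc m"] hermitian_form_power_gram[of A k w U m c] gram
      unfolding f_def by metis
    then have "(\<Sum>u\<in>U. Re (f u)) = 0" by (metis Re_sum zero_complex.sel(1))
    moreover have f: "Im (f u) = 0 \<and> 0 \<le> Re (f u)" for u
      unfolding f_def by (rule hermitian_form_power_nonneg[OF gram])
    ultimately have "Re (f u) = 0"
      using sum_nonneg_eq_0_iff[OF \<open>finite U\<close>, of "\<lambda>u. Re (f u)"] Cons.prems(2) by auto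
    then show ?thesis using f[of u] by (simp add: f_def complex_eq_iff)
  qed
  from Cons.IH[OF this] Cons.prems(2) show ?case by (simp add: mult.assoc)
qed

text \<open>Lagrange interpolation. Coefficients that annihilate all monomials keep this property after
multiplication by \<open>w v x - w v b\<close>; one such factor for each \<open>b \<noteq> a\<close> leaves coefficients supported at
\<open>a\<close> alone, and the empty monomial then shows that the remaining value is zero.\<close>

lemma separated_words_independent:
  fixes w :: "'b \<Rightarrow> 'a \<Rightarrow> 'c :: idom"
  assumes "finite A" "a \<in> A"
    and sep: "\<And>x. x \<in> A \<Longrightarrow> x \<noteq> a \<Longrightarrow> \<exists>u\<in>U. w u x \<noteq> w u a"
    and words: "\<And>us. set us \<subseteq> U \<Longrightarrow> (\<Sum>x\<in>A. c x * (\<Prod>u\<leftarrow>us. w u x)) = 0"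
  shows "c a = 0"
proof -
  have "\<exists>e. (\<forall>us. set us \<subseteq> U \<longrightarrow> (\<Sum>x\<in>A. e x * (\<Prod>u\<leftarrow>us. w u x)) = 0) \<and>
            (\<forall>x\<in>J. e x = 0) \<and> (e a = 0 \<longrightarrow> c a = 0)"
    if "finite J" "J \<subseteq> A - {a}" for J
    using that
  proof (induction J)
    case empty
    then show ?case using words by blast
  next
    case (insert b J)
    then obtain e where e: "\<And>us. set us \<subseteq> U \<Longrightarrow> (\<Sum>x\<in>A. e x * (\<Prod>u\<leftarrow>us. w u x)) = 0"
      "\<And>x. x \<in> J \<Longrightarrow> e x = 0" "e a = 0 \<longrightarrow> c a = 0" by auto
    obtain v where v: "v \<in> U" "w v b \<noteq> w v a" using sep[of b] insert.prems by auto
    define e' where "e' = (\<lambda>x. e x * (w v x - w v b))"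
    have "(\<Sum>x\<in>A. e' x * (\<Prod>u\<leftarrow>us. w u x)) = 0" if "set us \<subseteq> U" for us
    proof -
      have "(\<Sum>x\<in>A. e' x * (\<Prod>u\<leftarrow>us. w u x))
          = (\<Sum>x\<in>A. e x * (\<Prod>u\<leftarrow>v # us. w u x)) - w v b * (\<Sum>x\<in>A. e x * (\<Prod>u\<leftarrow>us. w u x))"
        by (simp add: e'_def sum_distrib_left sum_subtractf[symmetric] algebra_simps)
      then show ?thesis using e(1)[of "v # us"] e(1)[of us] that v by simp
    qed
    then show ?case using e v by (intro exI[of _ e']) (auto simp: e'_def)
  qed
  from this[of "A - {a}"] \<open>finite A\<close>
  obtain e where e: "\<And>us. set us \<subseteq> U \<Longrightarrow> (\<Sum>x\<in>A. e x * (\<Prod>u\<leftarrow>us. w u x)) = 0"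
    "\<forall>x\<in>A - {a}. e x = 0" "e a = 0 \<longrightarrow> c a = 0" by auto
  have "(\<Sum>x\<in>A. e x) = 0" using e(1)[of "[]"] by simp
  moreover have "(\<Sum>x\<in>A. e x) = e a" using e(2) assms by (simp add: sum.remove)
  ultimately show ?thesis using e by simp
qed

text \<open>Expanding the exponential writes the form as a series of the forms of the powers \<open>k ^ m\<close> with
positive weights \<open>t ^ m / fact m\<close>. All terms are nonnegative, and if they all vanish, then the
coefficients annihilate all monomials in the Gram vectors, which separate the points.\<close>

lemma hermitian_form_exp_pos:
  fixes k :: "'a \<Rightarrow> 'a \<Rightarrow> complex" and t :: real
  assumes psd: "positive_semidefinite_on X k"
    and sep: "\<And>a b. a \<in> X \<Longrightarrow> b \<in> X \<Longrightarrow> a \<noteq> b \<Longrightarrow> \<exists>z\<in>X. k z a \<noteq> k z b"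
    and "t > 0" and A: "finite A" "A \<subseteq> X" and nz: "x0 \<in> A" "c x0 \<noteq> 0"
  defines "s \<equiv> hermitian_form A (\<lambda>x y. exp (of_real t * k x y)) c"
  shows "Im s = 0" "0 < Re s"
proof -
  have "\<forall>a b. \<exists>z. a \<in> A \<longrightarrow> b \<in> A \<longrightarrow> a \<noteq> b \<longrightarrow> z \<in> X \<and> k z a \<noteq> k z b"
    using sep A(2) by (meson subsetD)
  then obtain f where f': "\<forall>a b. a \<in> A \<longrightarrow> b \<in> A \<longrightarrow> a \<noteq> b \<longrightarrow> f a b \<in> X \<and> k (f a b) a \<noteq> k (f a b) b"
    by metis
  then have f: "\<And>a b. a \<in> A \<Longrightarrow> b \<in> A \<Longrightarrow> a \<noteq> b \<Longrightarrow> f a b \<in> X \<and> k (f a b) a \<noteq> k (f a b) b"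
    by blast
  \<comment> \<open>Equal Gram vectors of \<open>a\<close> and \<open>b\<close> give \<open>k z a = k z b\<close> only for the points \<open>z\<close> over which the
    vectors are formed, so the separating points \<open>f a b\<close> are included.\<close>
  define U where "U = A \<union> (\<lambda>(a, b). f a b) ` {(a, b). a \<in> A \<and> b \<in> A \<and> a \<noteq> b}"
  have "finite {(a, b). a \<in> A \<and> b \<in> A \<and> a \<noteq> b}"
    by (rule finite_subset[of _ "A \<times> A"]) (use A in auto)
  then have U: "finite U" "U \<subseteq> X" "A \<subseteq> U" using A f by (auto simp: U_def)
  obtain w where w': "\<forall>x\<in>U. \<forall>y\<in>U. k y x = (\<Sum>u\<in>U. w u x * cnj (w u y))"
    using psd_gram_vectors[OF U(1) psd_subset[OF psd U(2)]] by (elim exE)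
  have w: "\<And>x y. x \<in> U \<Longrightarrow> y \<in> U \<Longrightarrow> k y x = (\<Sum>u\<in>U. w u x * cnj (w u y))"
    using w' by blast
  have gram: "\<And>x y. x \<in> A \<Longrightarrow> y \<in> A \<Longrightarrow> k y x = (\<Sum>u\<in>U. w u x * cnj (w u y))"
    using w U(3) by blast
  have wsep: "\<exists>u\<in>U. w u a \<noteq> w u b" if ab: "a \<in> A" "b \<in> A" "a \<noteq> b" for a b
  proof (rule ccontr)
    assume "\<not> (\<exists>u\<in>U. w u a \<noteq> w u b)"
    then have eq: "w u a = w u b" if "u \<in> U" for u using that by blast
    have fU: "f a b \<in> U" using ab unfolding U_def by auto
    have aU: "a \<in> U" "b \<in> U" using ab U(3) by auto
    have "k (f a b) a = k (f a b) b"
      unfolding w[OF aU(1) fU] w[OF aU(2) fU] using eq by simp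
    then show False using f[OF ab] by simp
  qed
  define q where "q = (\<lambda>m. hermitian_form A (\<lambda>x y. k x y ^ m) c)"
  have q: "Im (q m) = 0 \<and> 0 \<le> Re (q m)" for m
    unfolding q_def by (rule hermitian_form_power_nonneg[of A k w U, OF gram])
  have "(\<lambda>m. \<Sum>x\<in>A. \<Sum>y\<in>A. c x * cnj (c y) * ((of_real t * k y x) ^ m /\<^sub>R fact m)) sums s"
    unfolding s_def hermitian_form_def by (intro sums_sum sums_mult exp_converges)
  also have "(\<lambda>m. \<Sum>x\<in>A. \<Sum>y\<in>A. c x * cnj (c y) * ((of_real t * k y x) ^ m /\<^sub>R fact m))
      = (\<lambda>m. of_real (t ^ m / fact m) * q m)"
    unfolding q_def hermitian_form_def
    by (simp add: sum_distrib_left scaleR_conv_of_real field_simps)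
  finally have "(\<lambda>m. of_real (t ^ m / fact m) * q m) sums s" .
  moreover have "of_real (t ^ m / fact m) * q m = of_real (t ^ m / fact m * Re (q m))" for m
    using q[of m] unfolding of_real_mult by (metis complex_is_Real_iff of_real_Re)
  ultimately have sums: "(\<lambda>m. complex_of_real (t ^ m / fact m * Re (q m))) sums s" by (simp only:)
  have Re: "(\<lambda>m. t ^ m / fact m * Re (q m)) sums Re s"
    using sums_Re[OF sums] unfolding Re_complex_of_real .
  have "(\<lambda>m. 0) sums Im s"
    using sums_Im[OF sums] unfolding Im_complex_of_real .
  then have Im: "Im s = 0" using sums_unique2 sums_zero by blast
  have pos: "0 \<le> t ^ m / fact m * Re (q m)" for m using q \<open>t > 0\<close> by simp
  have "0 \<noteq> Re s"
  proof (rule not_sym, rule notI)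
    assume "Re s = 0"
    then have "t ^ m / fact m * Re (q m) = 0" for m
      using suminf_eq_zero_iff[OF sums_summable[OF Re] pos] sums_unique[OF Re] by metis
    then have "Re (q m) = 0" for m using \<open>t > 0\<close> by simp
    then have q0: "hermitian_form A (\<lambda>x y. k x y ^ m) c = 0" for m
      using q[of m] unfolding q_def by (simp add: complex_eq_iff)
    have "c a = 0" if "a \<in> A" for a
    proof (rule separated_words_independent[OF A(1) that])
      show "\<exists>u\<in>U. w u x \<noteq> w u a" if "x \<in> A" "x \<noteq> a" for x
        using wsep[OF that(1) \<open>a \<in> A\<close> that(2)] .
      show "(\<Sum>x\<in>A. c x * (\<Prod>u\<leftarrow>us. w u x)) = 0" if "set us \<subseteq> U" for us
        by (rule hermitian_form_power_zero_words[OF gram U(1) q0 that])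
    qed
    then show False using nz by blast
  qed
  moreover have "0 \<le> Re s" by (rule sums_le[OF pos sums_zero Re])
  ultimately show "0 < Re s" by (rule order.not_eq_order_implies_strict)
  show "Im s = 0" by (rule Im)
qed

text \<open>The condition \<open>sep\<close> says that the kernel functions \<open>\<lambda>z. k z a\<close> are pairwise distinct. It is also
necessary: equal kernel functions at \<open>a \<noteq> b\<close> give two equal columns of the exponential.\<close>

theorem exp_kernel_strictly_positive_definite:
  fixes k :: "'a \<Rightarrow> 'a \<Rightarrow> complex" and t :: real
  assumes psd: "positive_semidefinite_on X k"
    and sep: "\<And>a b. a \<in> X \<Longrightarrow> b \<in> X \<Longrightarrow> a \<noteq> b \<Longrightarrow> \<exists>z\<in>X. k z a \<noteq> k z b"
    and "t > 0"
  shows "strictly_positive_definite_on X (\<lambda>z l. exp (of_real t * k z l))"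
proof -
  have herm: "\<forall>x\<in>X. \<forall>y\<in>X. exp (of_real t * k x y) = cnj (exp (of_real t * k y x))"
  proof (intro ballI)
    fix x y assume "x \<in> X" "y \<in> X"
    then have "k x y = cnj (k y x)" by (rule psd_hermitian[OF psd])
    then show "exp (of_real t * k x y) = cnj (exp (of_real t * k y x))" by (simp add: exp_cnj)
  qed
  define S where "S n c p = (\<Sum>i<n. \<Sum>j<n. c i * cnj (c j) * exp (of_real t * k (p j) (p i)))"
    for n :: nat and c :: "nat \<Rightarrow> complex" and p :: "nat \<Rightarrow> 'a"
  have "S n c p \<in> \<real> \<and> 0 < Re (S n c p)"
    if p: "\<forall>i<n. p i \<in> X" "inj_on p {..<n}" and nz: "\<exists>i<n. c i \<noteq> 0" for n c p
  proof -
    define e where "e = (\<lambda>x. c (the_inv_into {..<n} p x))"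
    have e: "e (p i) = c i" if "i < n" for i
      using p that by (simp add: e_def the_inv_into_f_f)
    have s: "S n c p = hermitian_form (p ` {..<n}) (\<lambda>x y. exp (of_real t * k x y)) e"
      using p(2) e unfolding hermitian_form_def S_def by (auto simp: sum.reindex intro!: sum.cong)
    obtain i where i: "i < n" "c i \<noteq> 0" using nz by blast
    have A: "finite (p ` {..<n})" "p ` {..<n} \<subseteq> X" "p i \<in> p ` {..<n}" "e (p i) \<noteq> 0"
      using p i e by auto
    note pos = hermitian_form_exp_pos[where c = e, OF psd sep \<open>t > 0\<close> A]
    show ?thesis
      unfolding s complex_is_Real_iff using pos by (rule conjI)
  qed
  then have "\<forall>n c p. (\<forall>i<n. p i \<in> X) \<and> inj_on p {..<n} \<and> (\<exists>i<n. c i \<noteq> 0)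
      \<longrightarrow> S n c p \<in> \<real> \<and> 0 < Re (S n c p)"
    by (intro allI impI) (elim conjE, simp only: refl simp_thms)
  with herm show ?thesis
    unfolding strictly_positive_definite_on_def Let_def S_def by (rule conjI)
qed

section \<open>Cauchy's formula for arc length\<close>

lemma space_arc_measure [simp]: "space arc_measure = sphere 0 1"
  by (simp add: arc_measure_def space_restrict_space)

lemma sets_arc_measure: "sets arc_measure = sets (restrict_space borel (sphere 0 1))"
  by (simp add: arc_measure_def)

lemma cis_measurable_sphere: "cis \<in> measurable borel (restrict_space borel (sphere 0 1))"
proof (rule measurable_restrict_space2)
  show "cis \<in> borel_measurable borel"
    by (intro borel_measurable_continuous_onI continuous_intros)
qed simp

lemma prob_space_arc_measure: "prob_space arc_measure"
  unfolding arc_measure_def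
proof (rule prob_space.prob_space_distr)
  show "prob_space (uniform_measure lborel {0..2 * pi})"
    by (rule prob_space_uniform_measure) auto
  show "cis \<in> measurable (uniform_measure lborel {0..2 * pi}) (restrict_space borel (sphere 0 1))"
    using cis_measurable_sphere by (simp add: measurable_def)
qed

lemma borel_measurable_arc_continuous:
  fixes f :: "complex \<Rightarrow> 'b :: {second_countable_topology, real_normed_vector}"
  assumes "continuous_on (sphere 0 1) f" "sets M = sets arc_measure"
  shows "f \<in> borel_measurable M"
proof -
  have "f \<in> borel_measurable (restrict_space borel (sphere 0 1))"
    by (rule borel_measurable_continuous_on_restrict) fact
  then show ?thesis using assms(2) sets_arc_measure by (metis measurable_cong_sets)
qed

lemma bounded_on_unit_circle:
  fixes f :: "complex \<Rightarrow> 'b :: real_normed_vector"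
  assumes "continuous_on (sphere 0 1) f"
  obtains b where "\<And>\<zeta>. norm \<zeta> = 1 \<Longrightarrow> norm (f \<zeta>) \<le> b"
proof -
  have "compact (f ` sphere 0 1)" using assms by (intro compact_continuous_image) auto
  then obtain b where "\<forall>x\<in>f ` sphere 0 1. norm x \<le> b"
    using compact_imp_bounded bounded_iff by metis
  then show thesis by (intro that[of b]) auto
qed

lemma integrable_arc_continuous:
  fixes f :: "complex \<Rightarrow> 'b :: {second_countable_topology, banach}"
  assumes "continuous_on (sphere 0 1) f" "sets M = sets arc_measure" "finite_measure M"
  shows "integrable M f"
proof -
  interpret finite_measure M by fact
  have sp: "space M = sphere 0 1" using sets_eq_imp_space_eq[OF assms(2)] by simp
  obtain b where "\<And>\<zeta>. norm \<zeta> = 1 \<Longrightarrow> norm (f \<zeta>) \<le> b"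
    using bounded_on_unit_circle[OF assms(1)] by blast
  then show ?thesis
    by (intro integrable_const_bound[where B = b] AE_I2 borel_measurable_arc_continuous assms)
       (auto simp: sp)
qed

lemma integral_arc_measure:
  fixes f :: "complex \<Rightarrow> complex"
  assumes f: "continuous_on (sphere 0 1) f"
  shows "(LINT \<zeta>|arc_measure. f \<zeta>) = integral {0..2 * pi} (\<lambda>t. f (cis t)) / (2 * pi)"
proof -
  have meas: "f \<in> borel_measurable (restrict_space borel (sphere 0 1))"
    by (rule borel_measurable_continuous_on_restrict) fact
  have cont: "continuous_on {0..2 * pi} (\<lambda>t. f (cis t))"
    by (rule continuous_on_compose2[OF f]) (auto intro!: continuous_intros)
  have mcis: "(\<lambda>t. f (cis t)) \<in> borel_measurable borel"
    using measurable_compose[OF cis_measurable_sphere meas] .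
  have dens: "uniform_measure lborel {0..2 * pi}
      = density lborel (\<lambda>t. ennreal (indicator {0..2 * pi} t / (2 * pi)))"
    unfolding uniform_measure_def
    by (intro density_cong) (auto simp: divide_ennreal[symmetric] ennreal_indicator)
  have "(LINT \<zeta>|arc_measure. f \<zeta>) = (LINT t|uniform_measure lborel {0..2 * pi}. f (cis t))"
    unfolding arc_measure_def
    by (rule integral_distr) (use cis_measurable_sphere meas in \<open>auto simp: measurable_def\<close>)
  also have "\<dots> = (LINT t|lborel. (indicator {0..2 * pi} t / (2 * pi)) *\<^sub>R f (cis t))"
    unfolding dens by (rule integral_density) (use mcis in auto)
  also have "\<dots> = (LINT t:{0..2 * pi}|lborel. f (cis t)) /\<^sub>R (2 * pi)"
    unfolding set_lebesgue_integral_def integral_scaleR_right[symmetric]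
    by (rule Bochner_Integration.integral_cong) (auto simp: field_simps)
  also have "(LINT t:{0..2 * pi}|lborel. f (cis t)) = integral {0..2 * pi} (\<lambda>t. f (cis t))"
    by (rule set_borel_integral_eq_integral(2)[OF borel_integrable_atLeastAtMost'[OF cont]])
  finally show ?thesis by (simp add: scaleR_conv_of_real field_simps)
qed

text \<open>Cauchy's formula: on the unit circle \<open>d\<zeta> / (2 * pi * \<i> * \<zeta>)\<close> is normalised arc length, which turns
the Cauchy kernel \<open>1 / (\<zeta> - w)\<close> into \<open>\<zeta> / (\<zeta> - w)\<close>.\<close>

lemma cauchy_arc_measure:
  assumes cont: "continuous_on (cball 0 1) f" and hol: "f holomorphic_on ball 0 1" and "norm w < 1"
  shows "(LINT \<zeta>|arc_measure. f \<zeta> * (\<zeta> / (\<zeta> - w))) = f w"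
proof -
  have cont': "continuous_on (sphere 0 1) (\<lambda>\<zeta>. f \<zeta> * (\<zeta> / (\<zeta> - w)))"
    using \<open>norm w < 1\<close>
    by (intro continuous_intros continuous_on_subset[OF cont]) auto
  have "((\<lambda>u. f u / (u - w)) has_contour_integral (2 * of_real pi * \<i> * f w)) (circlepath 0 1)"
    using cont hol \<open>norm w < 1\<close> by (intro Cauchy_integral_circlepath) auto
  then have "((\<lambda>t. f (cis t) / (cis t - w) * \<i> * cis t) has_integral (2 * of_real pi * \<i> * f w)) {0..2 * pi}"
    unfolding circlepath_def by (subst (asm) has_contour_integral_part_circlepath_iff) auto
  then have "((\<lambda>t. f (cis t) / (cis t - w) * \<i> * cis t / \<i>) has_integral (2 * of_real pi * \<i> * f w / \<i>)) {0..2 * pi}"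
    by (rule has_integral_divide)
  moreover have "f (cis t) / (cis t - w) * \<i> * cis t / \<i> = f (cis t) * (cis t / (cis t - w))" for t
    by (simp add: mult_ac)
  ultimately have "((\<lambda>t. f (cis t) * (cis t / (cis t - w))) has_integral (2 * of_real pi * f w)) {0..2 * pi}"
    by (simp add: mult_ac)
  then have "integral {0..2 * pi} (\<lambda>t. f (cis t) * (cis t / (cis t - w))) = 2 * of_real pi * f w"
    by (rule integral_unique)
  then show ?thesis unfolding integral_arc_measure[OF cont'] by simp
qed

section \<open>The de Branges-Rovnyak kernel\<close>

text \<open>On the circle \<open>cnj \<zeta> = 1 / \<zeta>\<close>, so the conjugate of the Szego kernel at \<open>w\<close> is the Cauchy kernel.\<close>

lemma szego_reproducing:
  assumes cont: "continuous_on (cball 0 1) f" and hol: "f holomorphic_on ball 0 1" and w: "norm w < 1"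
  shows "(LINT \<zeta>|arc_measure. f \<zeta> * cnj (1 / (1 - cnj w * \<zeta>))) = f w"
proof -
  have "cnj (1 / (1 - cnj w * \<zeta>)) = \<zeta> / (\<zeta> - w)" if "\<zeta> \<in> sphere 0 1" for \<zeta>
  proof -
    have \<zeta>: "\<zeta> * cnj \<zeta> = 1" using that by (simp flip: complex_norm_square)
    have "\<zeta> - w = \<zeta> * (1 - w * cnj \<zeta>)" using \<zeta> by (simp add: algebra_simps)
    moreover have "\<zeta> \<noteq> 0" using that by auto
    ultimately show ?thesis by simp
  qed
  then have "(LINT \<zeta>|arc_measure. f \<zeta> * cnj (1 / (1 - cnj w * \<zeta>)))
      = (LINT \<zeta>|arc_measure. f \<zeta> * (\<zeta> / (\<zeta> - w)))"
    by (intro Bochner_Integration.integral_cong refl) simp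
  then show ?thesis using cauchy_arc_measure[OF assms] by simp
qed

lemma one_minus_cnj_mult_nonzero: "norm x < 1 \<Longrightarrow> norm z \<le> 1 \<Longrightarrow> 1 - cnj x * z \<noteq> 0"
proof
  assume "norm x < 1" "norm z \<le> 1" "1 - cnj x * z = 0"
  then have "norm (cnj x * z) = 1" by simp
  moreover have "norm (cnj x * z) \<le> norm x * 1"
    unfolding norm_mult using \<open>norm z \<le> 1\<close> by (intro mult_mono) auto
  ultimately show False using \<open>norm x < 1\<close> by simp
qed

text \<open>Multiplication by \<open>\<psi>\<close> is a contraction of the Hardy space, and its adjoint maps the Szego kernel \<open>e x\<close>
to \<open>cnj (\<psi> x)\<close> times itself. With \<open>g = \<Sum>x\<in>A. c x * e x\<close> and its image \<open>h\<close> under the adjoint, the form is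
\<open>\<parallel>g\<parallel>\<^sup>2 - \<parallel>h\<parallel>\<^sup>2\<close>. As \<open>\<langle>\<psi> h, g\<rangle> = \<parallel>h\<parallel>\<^sup>2\<close>, expanding \<open>\<parallel>\<psi> h - g\<parallel>\<^sup>2 \<ge> 0\<close> and using \<open>\<parallel>\<psi> h\<parallel> \<le> \<parallel>h\<parallel>\<close> gives
the claim. Continuity up to the circle lets the inner products be honest integrals.\<close>

lemma schur_form_nonneg_boundary:
  assumes cont: "continuous_on (cball 0 1) \<psi>" and hol: "\<psi> holomorphic_on ball 0 1"
    and bound: "\<And>\<zeta>. norm \<zeta> = 1 \<Longrightarrow> norm (\<psi> \<zeta>) \<le> 1"
    and A: "finite A" "A \<subseteq> ball 0 1"
  shows "0 \<le> Re (hermitian_form A (\<lambda>z l. (1 - cnj (\<psi> l) * \<psi> z) / (1 - cnj l * z)) c)"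
proof -
  interpret prob_space arc_measure by (rule prob_space_arc_measure)
  have fin: "finite_measure arc_measure" by (rule finite_measure_axioms)
  define e where "e = (\<lambda>x z. 1 / (1 - cnj x * z :: complex))"
  define g where "g = (\<lambda>z. \<Sum>x\<in>A. c x * e x z)"
  define h where "h = (\<lambda>z. \<Sum>x\<in>A. c x * cnj (\<psi> x) * e x z)"
  have nz: "1 - cnj x * z \<noteq> 0" if "x \<in> A" "norm z \<le> 1" for x z
    using that A by (intro one_minus_cnj_mult_nonzero) auto
  have ce: "continuous_on (cball 0 1) (e x)" and he: "e x holomorphic_on ball 0 1" if "x \<in> A" for x
    unfolding e_def using nz[OF that] by (auto intro!: continuous_intros holomorphic_intros)
  have cg: "continuous_on (cball 0 1) g" and ch: "continuous_on (cball 0 1) h"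
    unfolding g_def h_def using ce by (auto intro!: continuous_intros)
  have hg: "g holomorphic_on ball 0 1" and hh: "h holomorphic_on ball 0 1"
    unfolding g_def h_def using he by (auto intro!: holomorphic_intros)
  have sph: "sphere 0 1 \<subseteq> cball (0::complex) 1" by auto
  note [continuous_intros] = continuous_on_subset[OF cg sph] continuous_on_subset[OF ch sph]
    continuous_on_subset[OF cont sph] continuous_on_subset[OF ce sph]
  note int = integrable_arc_continuous[OF _ refl fin]
  have repr: "(LINT \<zeta>|arc_measure. f \<zeta> * cnj (\<Sum>x\<in>A. b x * e x \<zeta>)) = (\<Sum>y\<in>A. cnj (b y) * f y)"
    if f: "continuous_on (cball 0 1) f" "f holomorphic_on ball 0 1" for f b
  proof -
    have "(LINT \<zeta>|arc_measure. f \<zeta> * cnj (\<Sum>x\<in>A. b x * e x \<zeta>))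
        = (LINT \<zeta>|arc_measure. (\<Sum>x\<in>A. cnj (b x) * (f \<zeta> * cnj (e x \<zeta>))))"
      by (simp add: sum_distrib_left mult_ac)
    also have "\<dots> = (\<Sum>x\<in>A. cnj (b x) * (LINT \<zeta>|arc_measure. f \<zeta> * cnj (e x \<zeta>)))"
      by (subst Bochner_Integration.integral_sum)
         (auto intro!: int continuous_intros continuous_on_subset[OF f(1) sph])
    also have "\<dots> = (\<Sum>y\<in>A. cnj (b y) * f y)"
    proof (intro sum.cong refl)
      fix x assume "x \<in> A"
      then have "norm x < 1" using A by auto
      then show "cnj (b x) * (LINT \<zeta>|arc_measure. f \<zeta> * cnj (e x \<zeta>)) = cnj (b x) * f x"
        unfolding e_def by (simp only: szego_reproducing[OF f])
    qed
    finally show ?thesis .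
  qed
  define G where "G = (LINT \<zeta>|arc_measure. g \<zeta> * cnj (g \<zeta>))"
  define H where "H = (LINT \<zeta>|arc_measure. h \<zeta> * cnj (h \<zeta>))"
  have G: "G = (\<Sum>y\<in>A. cnj (c y) * g y)"
    unfolding G_def using repr[OF cg hg, of c] by (simp add: g_def)
  have H: "H = (\<Sum>y\<in>A. cnj (c y) * (\<psi> y * h y))"
    unfolding H_def using repr[OF ch hh, of "\<lambda>x. c x * cnj (\<psi> x)"] by (simp add: h_def mult_ac)
  have cross: "(LINT \<zeta>|arc_measure. \<psi> \<zeta> * h \<zeta> * cnj (g \<zeta>)) = H"
    unfolding H using repr[of "\<lambda>z. \<psi> z * h z" c] cont ch hol hh
    by (simp add: g_def continuous_on_mult holomorphic_on_mult)
  have "hermitian_form A (\<lambda>z l. (1 - cnj (\<psi> l) * \<psi> z) / (1 - cnj l * z)) c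
      = (\<Sum>y\<in>A. \<Sum>x\<in>A. c x * cnj (c y) * ((1 - cnj (\<psi> x) * \<psi> y) / (1 - cnj x * y)))"
    unfolding hermitian_form_def by (rule sum.swap)
  also have "\<dots> = G - H"
    unfolding G H g_def h_def e_def
    by (simp add: sum_subtractf[symmetric] sum_distrib_left algebra_simps diff_divide_distrib)
  finally have form: "hermitian_form A (\<lambda>z l. (1 - cnj (\<psi> l) * \<psi> z) / (1 - cnj l * z)) c = G - H" .
  \<comment> \<open>The integrand of \<open>\<parallel>h\<parallel>\<^sup>2 - 2 * \<langle>\<psi> h, g\<rangle> + \<parallel>g\<parallel>\<^sup>2\<close>, whose real part dominates
    \<open>(norm (\<psi> \<zeta> * h \<zeta> - g \<zeta>))\<^sup>2\<close> pointwise.\<close>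
  define F where "F = (\<lambda>\<zeta>. h \<zeta> * cnj (h \<zeta>) - 2 * (\<psi> \<zeta> * h \<zeta> * cnj (g \<zeta>)) + g \<zeta> * cnj (g \<zeta>))"
  have i1: "integrable arc_measure (\<lambda>\<zeta>. h \<zeta> * cnj (h \<zeta>))"
    and i2: "integrable arc_measure (\<lambda>\<zeta>. \<psi> \<zeta> * h \<zeta> * cnj (g \<zeta>))"
    and i3: "integrable arc_measure (\<lambda>\<zeta>. g \<zeta> * cnj (g \<zeta>))"
    by (rule int; intro continuous_intros)+
  have "(LINT \<zeta>|arc_measure. F \<zeta>) = H - 2 * H + G"
    unfolding F_def using i1 i2 i3 by (simp add: cross H_def[symmetric] G_def[symmetric])
  then have "Re (G - H) = Re (LINT \<zeta>|arc_measure. F \<zeta>)" by simp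
  also have "\<dots> = (LINT \<zeta>|arc_measure. Re (F \<zeta>))"
    unfolding F_def using i1 i2 i3 by (intro integral_Re[symmetric]) simp
  also have "0 \<le> \<dots>"
  proof (rule Bochner_Integration.integral_nonneg)
    fix \<zeta> assume "\<zeta> \<in> space arc_measure"
    then have "norm (\<psi> \<zeta>) \<le> 1" by (intro bound) simp
    then have "norm (\<psi> \<zeta> * h \<zeta>) \<le> 1 * norm (h \<zeta>)"
      unfolding norm_mult by (intro mult_right_mono) auto
    then have "(norm (\<psi> \<zeta> * h \<zeta>))\<^sup>2 \<le> (norm (h \<zeta>))\<^sup>2" by (intro power_mono) auto
    moreover have "0 \<le> (norm (\<psi> \<zeta> * h \<zeta> - g \<zeta>))\<^sup>2" by simp
    moreover have "(norm (\<psi> \<zeta> * h \<zeta> - g \<zeta>))\<^sup>2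
        = (norm (\<psi> \<zeta> * h \<zeta>))\<^sup>2 - 2 * Re (\<psi> \<zeta> * h \<zeta> * cnj (g \<zeta>)) + (norm (g \<zeta>))\<^sup>2"
      unfolding cmod_power2 by (simp add: power2_eq_square algebra_simps)
    moreover have "Re (F \<zeta>) = (norm (h \<zeta>))\<^sup>2 - 2 * Re (\<psi> \<zeta> * h \<zeta> * cnj (g \<zeta>)) + (norm (g \<zeta>))\<^sup>2"
      unfolding F_def cmod_power2 by (simp add: power2_eq_square)
    ultimately show "0 \<le> Re (F \<zeta>)" by argo
  qed
  finally show ?thesis unfolding form .
qed

text \<open>A Schur function need not extend to the circle, but its dilations \<open>\<lambda>z. \<phi> (r * z)\<close> with \<open>r < 1\<close> do, and
their kernels converge pointwise as \<open>r\<close> tends to 1.\<close>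

theorem de_branges_rovnyak_kernel_psd:
  assumes "\<phi> \<in> Schur_class"
  shows "positive_semidefinite_on unit_disk (\<lambda>z l. (1 - cnj (\<phi> l) * \<phi> z) / (1 - cnj l * z))"
  unfolding positive_semidefinite_on_def
proof (intro conjI ballI allI impI)
  fix x y
  show "(1 - cnj (\<phi> y) * \<phi> x) / (1 - cnj y * x) = cnj ((1 - cnj (\<phi> x) * \<phi> y) / (1 - cnj x * y))"
    by (simp add: mult.commute)
next
  fix A c assume "finite A \<and> A \<subseteq> unit_disk"
  then have A: "finite A" "A \<subseteq> unit_disk" by auto
  have hol: "\<phi> holomorphic_on unit_disk" and bd: "\<And>z. z \<in> unit_disk \<Longrightarrow> norm (\<phi> z) \<le> 1"
    using assms by (auto simp: Schur_class_def)
  have cont: "continuous_on unit_disk \<phi>" using hol by (rule holomorphic_on_imp_continuous_on)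
  define r where "r = (\<lambda>n. 1 - inverse (real (Suc n)))"
  have r: "0 \<le> r n" "r n < 1" for n by (auto simp: r_def field_simps)
  have "r \<longlonglongrightarrow> 1 - 0" unfolding r_def by (intro tendsto_intros LIMSEQ_inverse_real_of_nat)
  then have lim: "(\<lambda>n. complex_of_real (r n) * z) \<longlonglongrightarrow> 1 * z" for z
    by (intro tendsto_intros) (metis diff_zero of_real_1 tendsto_of_real)
  have inside: "norm (complex_of_real (r n) * z) < 1" if "norm z \<le> 1" for n z
  proof -
    have "r n * norm z \<le> r n * 1" using r that by (intro mult_left_mono) auto
    then show ?thesis using r[of n] by (simp add: norm_mult)
  qed
  define K where "K = (\<lambda>\<psi> z l. (1 - cnj (\<psi> l) * \<psi> z) / (1 - cnj l * z :: complex))"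
  have "0 \<le> Re (hermitian_form A (K (\<lambda>z. \<phi> (of_real (r n) * z))) c)" for n
    unfolding K_def
  proof (rule schur_form_nonneg_boundary[OF _ _ _ A])
    show "continuous_on (cball 0 1) (\<lambda>z. \<phi> (of_real (r n) * z))"
      by (rule continuous_on_compose2[OF cont]) (auto intro!: continuous_intros inside)
    have "(\<phi> \<circ> (\<lambda>z. of_real (r n) * z)) holomorphic_on ball 0 1"
      by (rule holomorphic_on_compose_gen[OF _ hol]) (auto intro!: holomorphic_intros inside)
    then show "(\<lambda>z. \<phi> (of_real (r n) * z)) holomorphic_on ball 0 1" by (simp add: o_def)
    show "norm (\<phi> (of_real (r n) * \<zeta>)) \<le> 1" if "norm \<zeta> = 1" for \<zeta>
      using that inside[of \<zeta> n] by (intro bd) simp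
  qed
  moreover have "(\<lambda>n. Re (hermitian_form A (K (\<lambda>z. \<phi> (of_real (r n) * z))) c))
      \<longlonglongrightarrow> Re (hermitian_form A (K \<phi>) c)"
    unfolding hermitian_form_def
  proof (intro tendsto_intros)
    fix x y assume "x \<in> A" "y \<in> A"
    then have xy: "norm x < 1" "norm y < 1" using A by auto
    have lim\<phi>: "(\<lambda>n. \<phi> (of_real (r n) * z)) \<longlonglongrightarrow> \<phi> z" if "norm z < 1" for z
    proof -
      have "isCont \<phi> z" using cont that by (simp add: continuous_on_eq_continuous_at)
      then show ?thesis using lim[of z] by (intro isCont_tendsto_compose[of z \<phi>]) auto
    qed
    show "(\<lambda>n. K (\<lambda>z. \<phi> (of_real (r n) * z)) y x) \<longlonglongrightarrow> K \<phi> y x"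
      unfolding K_def using xy one_minus_cnj_mult_nonzero[of x y]
      by (intro tendsto_intros lim\<phi>) auto
  qed
  ultimately have "0 \<le> Re (hermitian_form A (K \<phi>) c)"
    by (intro LIMSEQ_le_const) auto
  then show "0 \<le> Re (hermitian_form A (\<lambda>z l. (1 - cnj (\<phi> l) * \<phi> z) / (1 - cnj l * z)) c)"
    by (simp only: K_def)
qed

section \<open>Herglotz integrals\<close>

lemma integrable_mult_bounded:
  fixes f h :: "'a \<Rightarrow> 'b :: {second_countable_topology, banach, real_normed_algebra}"
  assumes f: "f \<in> borel_measurable M" and bound: "\<And>\<zeta>. \<zeta> \<in> space M \<Longrightarrow> norm (f \<zeta>) \<le> b"
    and h: "integrable M h"
  shows "integrable M (\<lambda>\<zeta>. f \<zeta> * h \<zeta>)"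
proof (rule Bochner_Integration.integrable_bound)
  show "integrable M (\<lambda>\<zeta>. b * norm (h \<zeta>))" using h by simp
  show "(\<lambda>\<zeta>. f \<zeta> * h \<zeta>) \<in> borel_measurable M" using f h by measurable
  show "AE \<zeta> in M. norm (f \<zeta> * h \<zeta>) \<le> norm (b * norm (h \<zeta>))"
  proof (rule AE_I2)
    fix \<zeta> assume "\<zeta> \<in> space M"
    then have "norm (f \<zeta>) * norm (h \<zeta>) \<le> b * norm (h \<zeta>)"
      by (intro mult_right_mono bound) auto
    then show "norm (f \<zeta> * h \<zeta>) \<le> norm (b * norm (h \<zeta>))"
      using norm_mult_ineq[of "f \<zeta>" "h \<zeta>"] by simp
  qed
qed

lemma integrable_arc_continuous_mult:
  fixes f h :: "complex \<Rightarrow> 'b :: {second_countable_topology, banach, real_normed_algebra}"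
  assumes f: "continuous_on (sphere 0 1) f" and M: "sets M = sets arc_measure" and h: "integrable M h"
  shows "integrable M (\<lambda>\<zeta>. f \<zeta> * h \<zeta>)"
proof -
  have sp: "space M = sphere 0 1" using sets_eq_imp_space_eq[OF M] by simp
  obtain b where b: "\<And>\<zeta>. norm \<zeta> = 1 \<Longrightarrow> norm (f \<zeta>) \<le> b"
    using bounded_on_unit_circle[OF f] by blast
  show ?thesis
    by (rule integrable_mult_bounded[OF borel_measurable_arc_continuous[OF f M] _ h, of b]) (use b sp in auto)
qed

lemma herglotz_kernel_sums:
  assumes \<zeta>: "norm \<zeta> = 1" and z: "norm z < 1"
  shows "(\<lambda>n. (if n = 0 then 1 else 2) * cnj \<zeta> ^ n * z ^ n) sums ((\<zeta> + z) / (\<zeta> - z))"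
proof -
  define q where "q = cnj \<zeta> * z"
  have q: "norm q < 1" using \<zeta> z by (simp add: q_def norm_mult)
  have 1: "\<zeta> * cnj \<zeta> = 1" using \<zeta> by (simp flip: complex_norm_square)
  have nz: "\<zeta> \<noteq> 0" "1 - q \<noteq> 0" using \<zeta> q by auto
  have "\<zeta> + z = \<zeta> * (1 + q)" "\<zeta> - z = \<zeta> * (1 - q)"
    using 1 by (auto simp: q_def algebra_simps)
  then have "(\<zeta> + z) / (\<zeta> - z) = (1 + q) / (1 - q)" using nz by simp
  also have "\<dots> = 2 * (1 / (1 - q)) - 1" using nz by (simp add: field_simps)
  finally have eq: "(\<zeta> + z) / (\<zeta> - z) = 2 * (1 / (1 - q)) - 1" .
  have "(\<lambda>n. 2 * q ^ n - (if n = 0 then 1 else 0)) sums (2 * (1 / (1 - q)) - 1)"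
    by (intro sums_diff sums_mult geometric_sums q) (use sums_single[of 0 "\<lambda>_. 1"] in simp)
  also have "(\<lambda>n. 2 * q ^ n - (if n = 0 then 1 else 0)) = (\<lambda>n. (if n = 0 then 1 else 2) * cnj \<zeta> ^ n * z ^ n)"
    by (auto simp: fun_eq_iff q_def power_mult_distrib)
  finally show ?thesis unfolding eq .
qed

text \<open>The Taylor coefficients of a Herglotz integral are, up to the factor 2, the Fourier coefficients of
the measure. Integrating termwise is legitimate because the kernel series converges geometrically,
uniformly on the circle.\<close>

lemma herglotz_integral_sums:
  assumes M: "sets M = sets arc_measure" and f: "integrable M (f :: complex \<Rightarrow> complex)" and z: "norm z < 1"
  shows "(\<lambda>n. ((if n = 0 then 1 else 2) * (LINT \<zeta>|M. cnj \<zeta> ^ n * f \<zeta>)) * z ^ n)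
         sums (LINT \<zeta>|M. (\<zeta> + z) / (\<zeta> - z) * f \<zeta>)"
proof -
  have sp: "space M = sphere 0 1" using sets_eq_imp_space_eq[OF M] by simp
  define u where "u = (\<lambda>n \<zeta>. (if n = 0 then 1 else 2) * z ^ n * (cnj \<zeta> ^ n * f \<zeta>))"
  have intp: "integrable M (\<lambda>\<zeta>. cnj \<zeta> ^ n * f \<zeta>)" for n
    by (intro integrable_arc_continuous_mult[OF _ M f] continuous_intros)
  then have int: "integrable M (u n)" for n by (simp add: u_def)
  have normu: "norm (u n \<zeta>) = (if n = 0 then 1 else 2) * norm z ^ n * norm (f \<zeta>)"
    if "\<zeta> \<in> space M" for n \<zeta>
    using that sp by (simp add: u_def norm_mult norm_power)
  have geo: "summable (\<lambda>n. (if n = 0 then 1 else 2) * norm z ^ n)"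
  proof (rule summable_comparison_test)
    show "summable (\<lambda>n. 2 * norm z ^ n)" using z by (intro summable_mult summable_geometric) simp
    show "\<exists>N. \<forall>n\<ge>N. norm ((if n = 0 then 1 else 2) * norm z ^ n) \<le> 2 * norm z ^ n" by auto
  qed
  have "(\<lambda>n. integral\<^sup>L M (u n)) sums (LINT \<zeta>|M. (\<Sum>n. u n \<zeta>))"
  proof (rule sums_integral[OF int])
    show "AE \<zeta> in M. summable (\<lambda>n. norm (u n \<zeta>))"
      by (rule AE_I2) (use geo in \<open>simp add: normu summable_mult2\<close>)
    have "(LINT \<zeta>|M. norm (u n \<zeta>)) = (if n = 0 then 1 else 2) * norm z ^ n * (LINT \<zeta>|M. norm (f \<zeta>))" for n
      unfolding integral_mult_right_zero[symmetric]
      by (rule Bochner_Integration.integral_cong[OF refl]) (simp add: normu)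
    then show "summable (\<lambda>n. LINT \<zeta>|M. norm (u n \<zeta>))"
      using geo by (simp only: summable_mult2)
  qed
  also have "(LINT \<zeta>|M. (\<Sum>n. u n \<zeta>)) = (LINT \<zeta>|M. (\<zeta> + z) / (\<zeta> - z) * f \<zeta>)"
  proof (rule Bochner_Integration.integral_cong[OF refl])
    fix \<zeta> assume "\<zeta> \<in> space M"
    then have "norm \<zeta> = 1" using sp by simp
    from sums_mult2[OF herglotz_kernel_sums[OF this z], of "f \<zeta>"]
    have "(\<lambda>n. u n \<zeta>) sums ((\<zeta> + z) / (\<zeta> - z) * f \<zeta>)"
      by (simp add: u_def mult_ac)
    then show "(\<Sum>n. u n \<zeta>) = (\<zeta> + z) / (\<zeta> - z) * f \<zeta>" by (simp add: sums_iff)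
  qed
  also have "(\<lambda>n. integral\<^sup>L M (u n)) = (\<lambda>n. ((if n = 0 then 1 else 2) * (LINT \<zeta>|M. cnj \<zeta> ^ n * f \<zeta>)) * z ^ n)"
    by (simp add: u_def fun_eq_iff)
  finally show ?thesis .
qed

text \<open>The Schwarz integral formula, from \<open>2 * Re g = g + cnj g\<close>. Since \<open>(\<zeta> + z) / (\<zeta> - z) = 2 * \<zeta> / (\<zeta> - z) - 1\<close>,
the term with \<open>g\<close> is a Cauchy integral. On the circle the kernel is the conjugate of a function
holomorphic in \<open>\<zeta>\<close> with value 1 at 0, so the mean value property evaluates the term with \<open>cnj g\<close>.\<close>

lemma schwarz_formula:
  assumes cont: "continuous_on (cball 0 1) g" and hol: "g holomorphic_on ball 0 1" and z: "norm z < 1"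
  shows "(LINT \<zeta>|arc_measure. (\<zeta> + z) / (\<zeta> - z) * of_real (Re (g \<zeta>))) = g z - \<i> * of_real (Im (g 0))"
proof -
  interpret prob_space arc_measure by (rule prob_space_arc_measure)
  have fin: "finite_measure arc_measure" by (rule finite_measure_axioms)
  have sph: "sphere 0 1 \<subseteq> cball (0::complex) 1" by auto
  note contS = continuous_on_subset[OF cont sph]
  note int = integrable_arc_continuous[OF _ refl fin]
  have ne: "\<forall>\<zeta>\<in>sphere 0 1. \<zeta> - z \<noteq> 0" using z by auto
  have mean: "(LINT \<zeta>|arc_measure. f \<zeta>) = f 0"
    if "continuous_on (cball 0 1) f" "f holomorphic_on ball 0 1" for f
  proof -
    have "(LINT \<zeta>|arc_measure. f \<zeta>) = (LINT \<zeta>|arc_measure. f \<zeta> * (\<zeta> / (\<zeta> - 0)))"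
      by (rule Bochner_Integration.integral_cong) auto
    then show ?thesis using cauchy_arc_measure[OF that, of 0] by simp
  qed
  have i1: "integrable arc_measure (\<lambda>\<zeta>. g \<zeta> * (\<zeta> / (\<zeta> - z)))" and i2: "integrable arc_measure g"
    and i3: "integrable arc_measure (\<lambda>\<zeta>. (\<zeta> + z) / (\<zeta> - z) * g \<zeta>)"
    and i4: "integrable arc_measure (\<lambda>\<zeta>. (\<zeta> + z) / (\<zeta> - z) * cnj (g \<zeta>))"
    by (rule int; use ne in \<open>auto intro!: continuous_intros contS\<close>)+
  have "(LINT \<zeta>|arc_measure. (\<zeta> + z) / (\<zeta> - z) * g \<zeta>)
      = (LINT \<zeta>|arc_measure. 2 * (g \<zeta> * (\<zeta> / (\<zeta> - z))) - g \<zeta>)"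
    by (rule Bochner_Integration.integral_cong) (use ne in \<open>auto simp: field_simps\<close>)
  also have "\<dots> = 2 * g z - g 0"
    using i1 i2 by (simp only: Bochner_Integration.integral_diff integrable_mult_right
        integral_mult_right_zero mean[OF cont hol] cauchy_arc_measure[OF cont hol z])
  finally have A: "(LINT \<zeta>|arc_measure. (\<zeta> + z) / (\<zeta> - z) * g \<zeta>) = 2 * g z - g 0" .
  have nz: "1 - cnj z * \<zeta> \<noteq> 0" if "norm \<zeta> \<le> 1" for \<zeta>
    using one_minus_cnj_mult_nonzero[OF z that] .
  have "(LINT \<zeta>|arc_measure. (\<zeta> + z) / (\<zeta> - z) * cnj (g \<zeta>))
      = (LINT \<zeta>|arc_measure. cnj (g \<zeta> * ((1 + cnj z * \<zeta>) / (1 - cnj z * \<zeta>))))"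
  proof (rule Bochner_Integration.integral_cong[OF refl])
    fix \<zeta> assume "\<zeta> \<in> space arc_measure"
    then have "norm \<zeta> = 1" by simp
    then have 1: "\<zeta> * cnj \<zeta> = 1" by (simp flip: complex_norm_square)
    then have "\<zeta> \<noteq> 0" by auto
    have "\<zeta> + z = \<zeta> * (1 + z * cnj \<zeta>)" "\<zeta> - z = \<zeta> * (1 - z * cnj \<zeta>)"
      using 1 by (auto simp: algebra_simps)
    then have "(\<zeta> + z) / (\<zeta> - z) = (1 + z * cnj \<zeta>) / (1 - z * cnj \<zeta>)" using \<open>\<zeta> \<noteq> 0\<close> by simp
    then show "(\<zeta> + z) / (\<zeta> - z) * cnj (g \<zeta>) = cnj (g \<zeta> * ((1 + cnj z * \<zeta>) / (1 - cnj z * \<zeta>)))" by simp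
  qed
  also have "\<dots> = cnj (LINT \<zeta>|arc_measure. g \<zeta> * ((1 + cnj z * \<zeta>) / (1 - cnj z * \<zeta>)))"
    by (rule Bochner_Integration.integral_cnj)
  also have "(LINT \<zeta>|arc_measure. g \<zeta> * ((1 + cnj z * \<zeta>) / (1 - cnj z * \<zeta>))) = g 0"
    using nz by (subst mean) (auto intro!: continuous_intros holomorphic_intros cont hol)
  finally have B: "(LINT \<zeta>|arc_measure. (\<zeta> + z) / (\<zeta> - z) * cnj (g \<zeta>)) = cnj (g 0)" .
  have re: "of_real (Re w) = (w + cnj w) / 2" for w :: complex by (simp add: complex_eq_iff)
  have "(LINT \<zeta>|arc_measure. (\<zeta> + z) / (\<zeta> - z) * of_real (Re (g \<zeta>)))
     = (LINT \<zeta>|arc_measure. ((\<zeta> + z) / (\<zeta> - z) * g \<zeta> + (\<zeta> + z) / (\<zeta> - z) * cnj (g \<zeta>)) / 2)"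
    by (simp only: re distrib_left times_divide_eq_right)
  also have "\<dots> = (2 * g z - g 0 + cnj (g 0)) / 2"
    using i3 i4 by (simp only: integral_divide_zero Bochner_Integration.integral_add A B)
  also have "\<dots> = g z - \<i> * of_real (Im (g 0))" by (simp add: complex_eq_iff)
  finally show ?thesis .
qed

lemma power_series_coefficients_unique:
  fixes a b :: "nat \<Rightarrow> complex"
  assumes "\<And>z. norm z < 1 \<Longrightarrow> (\<lambda>n. a n * z ^ n) sums f z"
    and "\<And>z. norm z < 1 \<Longrightarrow> (\<lambda>n. b n * z ^ n) sums f z"
  shows "a n = b n"
proof (rule ccontr)
  assume ne: "a n \<noteq> b n"
  have s: "(\<lambda>n. (a n - b n) * (z - 0) ^ n) sums 0" if "norm (z - 0) < 1" for z
    using sums_diff[OF assms(1)[of z] assms(2)[of z]] that by (simp add: algebra_simps)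
  show False
  proof (cases "n = 0")
    case True
    have "(\<lambda>n. (a n - b n) * 0 ^ n) sums 0" using s[of 0] by simp
    then have "a 0 - b 0 = 0" by (simp only: powser_sums_zero_iff)
    then show False using ne True by simp
  next
    case False
    obtain r where "0 < r" "\<And>z. z \<in> cball 0 r - {0::complex} \<Longrightarrow> (0::complex) \<noteq> 0"
      by (rule powser_0_nonzero[of 1 0 "\<lambda>n. a n - b n" "\<lambda>_. 0" n]) (use s ne False in auto)
    from this(2)[of "of_real r"] \<open>0 < r\<close> show False by simp
  qed
qed

section \<open>Measures determined by their Fourier coefficients\<close>

text \<open>Let \<open>M\<close> be a finite positive measure and \<open>h\<close> an integrable density on the circle. The lemmas in this
context pass from equality of the Fourier coefficients of \<open>M\<close> and of the signed measure with density
\<open>h\<close> to equality on all Borel sets. The two sides are compared as integrals, so that the signed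
measure never has to be formed.\<close>

context
  fixes M :: "complex measure" and h :: "complex \<Rightarrow> real"
  assumes M: "sets M = sets arc_measure" and finM: "finite_measure M"
    and h: "integrable arc_measure h"
begin

lemma space_M: "space M = sphere 0 1"
  using sets_eq_imp_space_eq[OF M] by simp

lemma equal_integrals_bounded_limit:
  fixes f :: "complex \<Rightarrow> real"
  assumes s: "\<And>n. s n \<in> borel_measurable arc_measure" and f: "f \<in> borel_measurable arc_measure"
    and bound: "\<And>n \<zeta>. norm \<zeta> = 1 \<Longrightarrow> \<bar>s n \<zeta>\<bar> \<le> b"
    and lim: "\<And>\<zeta>. norm \<zeta> = 1 \<Longrightarrow> (\<lambda>n. s n \<zeta>) \<longlonglongrightarrow> f \<zeta>"
    and eq: "\<And>n. (LINT \<zeta>|M. s n \<zeta>) = (LINT \<zeta>|arc_measure. s n \<zeta> * h \<zeta>)"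
  shows "(LINT \<zeta>|M. f \<zeta>) = (LINT \<zeta>|arc_measure. f \<zeta> * h \<zeta>)"
proof -
  interpret finite_measure M by (rule finM)
  have mM: "g \<in> borel_measurable M \<longleftrightarrow> g \<in> borel_measurable arc_measure" for g :: "complex \<Rightarrow> real"
    using M by (simp cong: measurable_cong_sets)
  have hm: "h \<in> borel_measurable arc_measure" using h by (rule borel_measurable_integrable)
  have "(\<lambda>n. LINT \<zeta>|M. s n \<zeta>) \<longlonglongrightarrow> (LINT \<zeta>|M. f \<zeta>)"
    by (rule integral_dominated_convergence[where w = "\<lambda>_. b"])
       (use s f bound lim in \<open>auto simp: mM space_M intro!: AE_I2\<close>)
  moreover have "(\<lambda>n. LINT \<zeta>|arc_measure. s n \<zeta> * h \<zeta>) \<longlonglongrightarrow> (LINT \<zeta>|arc_measure. f \<zeta> * h \<zeta>)"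
  proof (rule integral_dominated_convergence[where w = "\<lambda>\<zeta>. b * \<bar>h \<zeta>\<bar>"])
    show "AE \<zeta> in arc_measure. norm (s n \<zeta> * h \<zeta>) \<le> b * \<bar>h \<zeta>\<bar>" for n
      by (rule AE_I2) (use bound in \<open>auto simp: abs_mult intro!: mult_right_mono\<close>)
    show "AE \<zeta> in arc_measure. (\<lambda>n. s n \<zeta> * h \<zeta>) \<longlonglongrightarrow> f \<zeta> * h \<zeta>"
      by (rule AE_I2) (use lim in \<open>auto intro!: tendsto_mult\<close>)
  qed (use s f hm h in auto)
  ultimately show ?thesis unfolding eq by (rule LIMSEQ_unique)
qed

text \<open>The functions \<open>f\<close> for which all products \<open>f * \<zeta> ^ j * cnj \<zeta> ^ k\<close> have equal integrals form a vector
space that is stable under multiplication by \<open>\<zeta>\<close> and \<open>cnj \<zeta>\<close>, hence under multiplication by every real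
linear form and so by every real polynomial. Stability under multiplication, instead of membership,
is the property that passes through products of polynomials. The constant 1 lies in the space because
on the circle \<open>\<zeta> ^ j * cnj \<zeta> ^ k\<close> is a power of \<open>cnj \<zeta>\<close> or the conjugate of one, and \<open>h\<close> is real.\<close>

lemma equal_moments_imp_equal_polynomial_integrals:
  assumes moments: "\<And>n. (LINT \<zeta>|M. cnj \<zeta> ^ n) = (LINT \<zeta>|arc_measure. cnj \<zeta> ^ n * of_real (h \<zeta>))"
    and p: "real_polynomial_function p"
  shows "(LINT \<zeta>|M. p \<zeta>) = (LINT \<zeta>|arc_measure. p \<zeta> * h \<zeta>)"
proof -
  define V where "V = {f :: complex \<Rightarrow> complex. continuous_on (sphere 0 1) f \<and>
    (\<forall>j k. (LINT \<zeta>|M. f \<zeta> * (\<zeta> ^ j * cnj \<zeta> ^ k))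
         = (LINT \<zeta>|arc_measure. f \<zeta> * (\<zeta> ^ j * cnj \<zeta> ^ k) * of_real (h \<zeta>)))}"
  note int = integrable_arc_continuous[OF _ M finM]
  have hc: "integrable arc_measure (\<lambda>\<zeta>. complex_of_real (h \<zeta>))" using h by simp
  note inth = integrable_arc_continuous_mult[OF _ refl hc]
  have one: "(\<lambda>_. 1) \<in> V"
  proof -
    have "(LINT \<zeta>|M. \<zeta> ^ j * cnj \<zeta> ^ k) = (LINT \<zeta>|arc_measure. \<zeta> ^ j * cnj \<zeta> ^ k * of_real (h \<zeta>))" for j k
    proof (cases "j \<le> k")
      case True
      have *: "\<zeta> ^ j * cnj \<zeta> ^ k = cnj \<zeta> ^ (k - j)" if "norm \<zeta> = 1" for \<zeta> :: complex
      proof -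
        have "\<zeta> * cnj \<zeta> = 1" using that by (simp flip: complex_norm_square)
        moreover have "\<zeta> ^ j * cnj \<zeta> ^ k = (\<zeta> * cnj \<zeta>) ^ j * cnj \<zeta> ^ (k - j)"
          using True by (simp add: power_mult_distrib flip: power_add mult.assoc)
        ultimately show ?thesis by simp
      qed
      have "(LINT \<zeta>|M. \<zeta> ^ j * cnj \<zeta> ^ k) = (LINT \<zeta>|M. cnj \<zeta> ^ (k - j))"
        by (rule Bochner_Integration.integral_cong) (auto simp: space_M *)
      also have "\<dots> = (LINT \<zeta>|arc_measure. cnj \<zeta> ^ (k - j) * of_real (h \<zeta>))" by (rule moments)
      also have "\<dots> = (LINT \<zeta>|arc_measure. \<zeta> ^ j * cnj \<zeta> ^ k * of_real (h \<zeta>))"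
        by (rule Bochner_Integration.integral_cong) (auto simp: *)
      finally show ?thesis .
    next
      case False
      have *: "\<zeta> ^ j * cnj \<zeta> ^ k = cnj (cnj \<zeta> ^ (j - k))" if "norm \<zeta> = 1" for \<zeta> :: complex
      proof -
        have "\<zeta> * cnj \<zeta> = 1" using that by (simp flip: complex_norm_square)
        moreover have "\<zeta> ^ j * cnj \<zeta> ^ k = (\<zeta> * cnj \<zeta>) ^ k * \<zeta> ^ (j - k)"
          using False by (simp add: power_mult_distrib mult_ac flip: power_add)
        ultimately show ?thesis by simp
      qed
      have "(LINT \<zeta>|M. \<zeta> ^ j * cnj \<zeta> ^ k) = (LINT \<zeta>|M. cnj (cnj \<zeta> ^ (j - k)))"
        by (rule Bochner_Integration.integral_cong) (auto simp: space_M *)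
      also have "\<dots> = cnj (LINT \<zeta>|arc_measure. cnj \<zeta> ^ (j - k) * of_real (h \<zeta>))"
        unfolding Bochner_Integration.integral_cnj moments ..
      also have "\<dots> = (LINT \<zeta>|arc_measure. cnj (cnj \<zeta> ^ (j - k) * of_real (h \<zeta>)))"
        by (rule Bochner_Integration.integral_cnj[symmetric])
      also have "\<dots> = (LINT \<zeta>|arc_measure. \<zeta> ^ j * cnj \<zeta> ^ k * of_real (h \<zeta>))"
        by (rule Bochner_Integration.integral_cong) (auto simp: *)
      finally show ?thesis .
    qed
    then show ?thesis by (simp add: V_def)
  qed
  have add: "(\<lambda>\<zeta>. f \<zeta> + g \<zeta>) \<in> V" if "f \<in> V" "g \<in> V" for f g
  proof -
    have cf: "continuous_on (sphere 0 1) f" and cg: "continuous_on (sphere 0 1) g"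
      using that by (auto simp: V_def)
    have "(LINT \<zeta>|M. (f \<zeta> + g \<zeta>) * (\<zeta> ^ j * cnj \<zeta> ^ k))
        = (LINT \<zeta>|arc_measure. (f \<zeta> + g \<zeta>) * (\<zeta> ^ j * cnj \<zeta> ^ k) * of_real (h \<zeta>))" for j k
    proof -
      have i: "integrable M (\<lambda>\<zeta>. u \<zeta> * (\<zeta> ^ j * cnj \<zeta> ^ k))"
        "integrable arc_measure (\<lambda>\<zeta>. u \<zeta> * (\<zeta> ^ j * cnj \<zeta> ^ k) * of_real (h \<zeta>))"
        if "continuous_on (sphere 0 1) u" for u :: "complex \<Rightarrow> complex"
        using that by (auto intro!: int inth continuous_intros)
      show ?thesis
        unfolding distrib_right
        using that i[OF cf] i[OF cg] by (simp only: Bochner_Integration.integral_add V_def mem_Collect_eq)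
    qed
    then show ?thesis using cf cg by (auto simp: V_def intro!: continuous_intros)
  qed
  have scale: "(\<lambda>\<zeta>. a * f \<zeta>) \<in> V" if "f \<in> V" for f a
    using that unfolding V_def by (auto simp: mult.assoc intro!: continuous_intros)
  have shift: "(\<lambda>\<zeta>. \<zeta> * f \<zeta>) \<in> V" if "f \<in> V" for f
  proof -
    have 1: "\<zeta> * f \<zeta> * (\<zeta> ^ j * cnj \<zeta> ^ k) = f \<zeta> * (\<zeta> ^ Suc j * cnj \<zeta> ^ k)" for \<zeta> j k
      by simp
    show ?thesis using that unfolding V_def mem_Collect_eq 1
      by (intro conjI allI continuous_intros) blast+
  qed
  have cshift: "(\<lambda>\<zeta>. cnj \<zeta> * f \<zeta>) \<in> V" if "f \<in> V" for f
  proof -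
    have 1: "cnj \<zeta> * f \<zeta> * (\<zeta> ^ j * cnj \<zeta> ^ k) = f \<zeta> * (\<zeta> ^ j * cnj \<zeta> ^ Suc k)" for \<zeta> j k
      by simp
    show ?thesis using that unfolding V_def mem_Collect_eq 1
      by (intro conjI allI continuous_intros) blast+
  qed
  have "(\<lambda>\<zeta>. of_real (p \<zeta>) * f \<zeta>) \<in> V" if "f \<in> V" for f
    using p that
  proof (induction p arbitrary: f rule: real_polynomial_function.induct)
    case (linear p)
    define a where "a = Complex (p 1) (- p \<i>) / 2"
    have lin: "of_real (p \<zeta>) = a * \<zeta> + cnj a * cnj \<zeta>" for \<zeta>
    proof -
      have "p \<zeta> = p (Re \<zeta> *\<^sub>R 1 + Im \<zeta> *\<^sub>R \<i>)"
        by (rule arg_cong[of _ _ p]) (simp add: complex_eq_iff)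
      also have "\<dots> = Re \<zeta> * p 1 + Im \<zeta> * p \<i>"
        using linear(1) by (simp add: linear_simps)
      finally show ?thesis by (simp add: complex_eq_iff a_def field_simps)
    qed
    have "(\<lambda>\<zeta>. a * (\<zeta> * f \<zeta>) + cnj a * (cnj \<zeta> * f \<zeta>)) \<in> V"
      by (intro add scale shift cshift linear)
    then show ?case by (simp add: lin distrib_right mult.assoc)
  next
    case (const c)
    then show ?case by (rule scale)
  next
    case (add p q)
    then show ?case using \<open>\<And>f g. f \<in> V \<Longrightarrow> g \<in> V \<Longrightarrow> (\<lambda>\<zeta>. f \<zeta> + g \<zeta>) \<in> V\<close>
      by (simp add: distrib_right)
  next
    case (mult p q)
    then show ?case by (simp add: mult.assoc)
  qed
  from this[OF one] have "(\<lambda>\<zeta>. of_real (p \<zeta>)) \<in> V" by simp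
  then have "(LINT \<zeta>|M. of_real (p \<zeta>) * (\<zeta> ^ 0 * cnj \<zeta> ^ 0)) =
      (LINT \<zeta>|arc_measure. of_real (p \<zeta>) * (\<zeta> ^ 0 * cnj \<zeta> ^ 0) * complex_of_real (h \<zeta>))"
    unfolding V_def by blast
  then have "(LINT \<zeta>|M. complex_of_real (p \<zeta>)) = (LINT \<zeta>|arc_measure. complex_of_real (p \<zeta> * h \<zeta>))"
    by simp
  then show ?thesis unfolding integral_complex_of_real of_real_eq_iff .
qed

lemma equal_moments_imp_equal_continuous_integrals:
  fixes f :: "complex \<Rightarrow> real"
  assumes moments: "\<And>n. (LINT \<zeta>|M. cnj \<zeta> ^ n) = (LINT \<zeta>|arc_measure. cnj \<zeta> ^ n * of_real (h \<zeta>))"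
    and f: "continuous_on (sphere 0 1) f"
  shows "(LINT \<zeta>|M. f \<zeta>) = (LINT \<zeta>|arc_measure. f \<zeta> * h \<zeta>)"
proof -
  have "\<exists>p. real_polynomial_function p \<and> (\<forall>\<zeta>\<in>sphere 0 1. \<bar>f \<zeta> - p \<zeta>\<bar> < inverse (real (Suc n)))" for n
    using Stone_Weierstrass_real_polynomial_function[OF compact_sphere f, of "inverse (real (Suc n))"]
    by (metis inverse_positive_iff_positive of_nat_0_less_iff zero_less_Suc)
  then obtain p where p: "\<And>n. real_polynomial_function (p n)"
    "\<And>n \<zeta>. norm \<zeta> = 1 \<Longrightarrow> \<bar>f \<zeta> - p n \<zeta>\<bar> < inverse (real (Suc n))"
    by (metis dist_0_norm mem_sphere)
  obtain b where b: "\<And>\<zeta>. norm \<zeta> = 1 \<Longrightarrow> norm (f \<zeta>) \<le> b"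
    using bounded_on_unit_circle[OF f] by blast
  show ?thesis
  proof (rule equal_integrals_bounded_limit[where s = p and b = "b + 1"])
    show "p n \<in> borel_measurable arc_measure" for n
      using p(1) by (intro borel_measurable_arc_continuous)
        (auto simp: real_polynomial_function_eq intro: continuous_on_polymonial_function)
    show "f \<in> borel_measurable arc_measure" by (intro borel_measurable_arc_continuous f refl)
    show "\<bar>p n \<zeta>\<bar> \<le> b + 1" if "norm \<zeta> = 1" for n \<zeta>
    proof -
      have "\<bar>f \<zeta>\<bar> \<le> b" using b[OF that] by simp
      moreover have "inverse (real (Suc n)) \<le> 1" by (simp add: field_simps)
      ultimately show ?thesis using p(2)[OF that, of n] by linarith
    qed
    show "(\<lambda>n. p n \<zeta>) \<longlonglongrightarrow> f \<zeta>" if "norm \<zeta> = 1" for \<zeta>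
      by (rule LIM_zero_cancel, rule Lim_null_comparison[OF _ LIMSEQ_inverse_real_of_nat])
         (use p(2)[OF that] in \<open>auto simp: abs_minus_commute simp del: of_nat_Suc intro!: always_eventually less_imp_le\<close>)
    show "(LINT \<zeta>|M. p n \<zeta>) = (LINT \<zeta>|arc_measure. p n \<zeta> * h \<zeta>)" for n
      by (rule equal_moments_imp_equal_polynomial_integrals[OF moments p(1)])
  qed
qed

text \<open>The indicator of a nonempty closed set \<open>C\<close> is the limit of the continuous functions
\<open>exp (- infdist \<zeta> C) ^ n\<close>. From closed sets the equality spreads to all Borel sets, because the
sets on which it holds form a Dynkin system.\<close>

lemma equal_moments_imp_equal_on_borel_sets:
  assumes moments: "\<And>n. (LINT \<zeta>|M. cnj \<zeta> ^ n) = (LINT \<zeta>|arc_measure. cnj \<zeta> ^ n * of_real (h \<zeta>))"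
    and B: "B \<in> sets (borel :: complex measure)"
  shows "(LINT \<zeta>|M. indicator B \<zeta>) = (LINT \<zeta>|arc_measure. indicator B \<zeta> * h \<zeta>)"
proof -
  note cont = equal_moments_imp_equal_continuous_integrals[OF moments]
  have ind: "(indicator B :: complex \<Rightarrow> real) \<in> borel_measurable arc_measure" if "B \<in> sets borel" for B
  proof -
    have "(indicator B :: complex \<Rightarrow> real) \<in> borel_measurable (restrict_space borel (sphere 0 1))"
      by (rule measurable_restrict_space1) (use that in simp)
    then show ?thesis unfolding measurable_cong_sets[OF sets_arc_measure refl] .
  qed
  interpret M: finite_measure M by (rule finM)
  have B': "B \<in> sigma_sets UNIV (Collect closed)"
    using B by (simp add: borel_eq_closed)
  have sig: "sigma_sets UNIV (Collect closed) = sets (borel :: complex measure)"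
    by (simp add: borel_eq_closed)
  have stable: "Int_stable (Collect closed :: complex set set)" by (auto simp: Int_stable_def)
  have Pow: "Collect closed \<subseteq> Pow (UNIV :: complex set)" by simp
  from stable Pow B' show ?thesis
  proof (induction rule: sigma_sets_induct_disjoint)
    case (basic C)
    then have C: "closed C" by simp
    show ?case
    proof (cases "C = {}")
      case False
      show ?thesis
      proof (rule equal_integrals_bounded_limit[where s = "\<lambda>n \<zeta>. exp (- infdist \<zeta> C) ^ n" and b = 1])
        have c: "continuous_on (sphere 0 1) (\<lambda>\<zeta>. exp (- infdist \<zeta> C) ^ n)" for n
          by (intro continuous_intros)
        show "(\<lambda>\<zeta>. exp (- infdist \<zeta> C) ^ n) \<in> borel_measurable arc_measure" for n
          by (intro borel_measurable_arc_continuous c refl)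
        show "(LINT \<zeta>|M. exp (- infdist \<zeta> C) ^ n) = (LINT \<zeta>|arc_measure. exp (- infdist \<zeta> C) ^ n * h \<zeta>)" for n
          by (rule cont[OF c])
        show "(indicator C :: complex \<Rightarrow> real) \<in> borel_measurable arc_measure" using C by (intro ind) simp
        show "\<bar>exp (- infdist \<zeta> C) ^ n\<bar> \<le> 1" for n \<zeta>
          by (simp add: infdist_nonneg power_le_one)
        show "(\<lambda>n. exp (- infdist \<zeta> C) ^ n) \<longlonglongrightarrow> indicator C \<zeta>" for \<zeta>
        proof (cases "\<zeta> \<in> C")
          case True
          then show ?thesis by simp
        next
          case False
          then have "infdist \<zeta> C \<noteq> 0" using in_closed_iff_infdist_zero[OF C \<open>C \<noteq> {}\<close>] by blast
          then have "0 < infdist \<zeta> C" using infdist_nonneg[of \<zeta> C] by linarith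
          then show ?thesis using False by (simp add: LIMSEQ_realpow_zero)
        qed
      qed
    qed simp
  next
    case empty
    show ?case by simp
  next
    case (compl D)
    then have mD: "D \<in> sets borel" by (simp only: sig)
    have mD': "(indicator D :: complex \<Rightarrow> real) \<in> borel_measurable M"
      using ind[OF mD] M by (simp cong: measurable_cong_sets)
    have eq: "indicator (UNIV - D) \<zeta> = 1 - (indicator D \<zeta> :: real)" for \<zeta>
      by (simp add: indicator_def)
    have i1: "integrable M (indicator D :: complex \<Rightarrow> real)"
      by (rule M.integrable_const_bound[where B = 1]) (use mD' in auto)
    have i2: "integrable arc_measure (\<lambda>\<zeta>. indicator D \<zeta> * h \<zeta>)"
      by (rule integrable_mult_bounded[OF ind[OF mD] _ h, of 1]) auto
    have "(LINT \<zeta>|M. 1) = (LINT \<zeta>|arc_measure. 1 * h \<zeta>)"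
      by (rule cont) simp
    then show ?case
      unfolding eq left_diff_distrib
      using i1 i2 h compl.IH by simp
  next
    case (union D)
    have mD: "D i \<in> sets borel" for i using union(2) unfolding sig by auto
    have mU: "(\<Union>i<n. D i) \<in> sets borel" for n using mD by auto
    show ?case
    proof (rule equal_integrals_bounded_limit[where s = "\<lambda>n. indicator (\<Union>i<n. D i)" and b = 1])
      show "(indicator (\<Union>i<n. D i) :: complex \<Rightarrow> real) \<in> borel_measurable arc_measure" for n
        by (rule ind[OF mU])
      show "(indicator (\<Union>i. D i) :: complex \<Rightarrow> real) \<in> borel_measurable arc_measure"
        using mD by (intro ind) auto
      show "\<bar>indicator (\<Union>i<n. D i) \<zeta> :: real\<bar> \<le> 1" for n \<zeta> by simp
      show "(\<lambda>n. indicator (\<Union>i<n. D i) \<zeta> :: real) \<longlonglongrightarrow> indicator (\<Union>i. D i) \<zeta>" for \<zeta>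
        by (rule LIMSEQ_indicator_UN)
      have dis: "indicator (\<Union>i<n. D i) \<zeta> = (\<Sum>i<n. indicator (D i) \<zeta> :: real)" for n \<zeta>
        by (rule indicator_UN_disjoint) (use union(1) in \<open>auto simp: disjoint_family_on_def\<close>)
      have i1: "integrable M (indicator (D i) :: complex \<Rightarrow> real)" for i
        by (rule M.integrable_const_bound[where B = 1])
          (use ind[OF mD[of i]] M in \<open>auto cong: measurable_cong_sets\<close>)
      have i2: "integrable arc_measure (\<lambda>\<zeta>. indicator (D i) \<zeta> * h \<zeta>)" for i
        by (rule integrable_mult_bounded[OF ind[OF mD[of i]] _ h, of 1]) auto
      show "(LINT \<zeta>|M. indicator (\<Union>i<n. D i) \<zeta>) = (LINT \<zeta>|arc_measure. indicator (\<Union>i<n. D i) \<zeta> * h \<zeta>)" for n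
        unfolding dis sum_distrib_right
        using i1 i2 union(3) by (subst (1 2) Bochner_Integration.integral_sum) auto
    qed
  qed
qed

text \<open>The measure \<open>M\<close> lives on a set of arc length zero, and on such a set the density \<open>h\<close> integrates to zero.\<close>

lemma equal_moments_singular_imp_null:
  assumes moments: "\<And>n. (LINT \<zeta>|M. cnj \<zeta> ^ n) = (LINT \<zeta>|arc_measure. cnj \<zeta> ^ n * of_real (h \<zeta>))"
    and sing: "mutually_singular M arc_measure"
  shows "space M \<in> null_sets M"
proof -
  interpret M: finite_measure M by (rule finM)
  obtain N where N: "N \<in> null_sets arc_measure" "space M - N \<in> null_sets M"
    using sing by (auto simp: mutually_singular_def)
  then have "N \<in> sets (restrict_space borel (sphere 0 1))" using sets_arc_measure by auto
  then obtain B where B: "B \<in> sets borel" "N = sphere 0 1 \<inter> B" by (auto simp: sets_restrict_space)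
  have NM: "N \<in> sets M" using N M by auto
  have "measure M N = (LINT \<zeta>|M. indicator N \<zeta>)" using NM by simp
  also have "\<dots> = (LINT \<zeta>|M. indicator B \<zeta>)"
    by (rule Bochner_Integration.integral_cong) (auto simp: B space_M indicator_def)
  also have "\<dots> = (LINT \<zeta>|arc_measure. indicator B \<zeta> * h \<zeta>)"
    by (rule equal_moments_imp_equal_on_borel_sets[OF moments B(1)])
  also have "\<dots> = 0"
  proof (rule integral_eq_zero_AE)
    show "AE \<zeta> in arc_measure. indicator B \<zeta> * h \<zeta> = 0"
      using AE_not_in[OF N(1)] AE_space by eventually_elim (auto simp: B indicator_def)
  qed
  finally have "N \<in> null_sets M"
    using NM by (simp add: null_sets_def M.emeasure_eq_measure)
  then have "N \<union> (space M - N) \<in> null_sets M" using N(2) by (rule null_sets.Un)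
  moreover have "N \<union> (space M - N) = space M" using NM sets.sets_into_space by blast
  ultimately show ?thesis by simp
qed

end

section \<open>Triviality of singular factors\<close>

text \<open>Equal Herglotz integrals have equal Taylor coefficients, so the measures have equal moments.\<close>

lemma herglotz_unique_singular:
  assumes sing: "mutually_singular M arc_measure" and fin: "finite_measure M"
    and h: "integrable arc_measure (h :: complex \<Rightarrow> real)"
    and eq: "\<And>z. norm z < 1 \<Longrightarrow> (LINT \<zeta>|M. (\<zeta> + z) / (\<zeta> - z))
        = (LINT \<zeta>|arc_measure. (\<zeta> + z) / (\<zeta> - z) * of_real (h \<zeta>))"
  shows "space M \<in> null_sets M"
proof -
  have M: "sets M = sets arc_measure" using sing by (simp add: mutually_singular_def)
  interpret finite_measure M by (rule fin)
  have one: "integrable M (\<lambda>_. 1 :: complex)" by simp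
  have hc: "integrable arc_measure (\<lambda>\<zeta>. complex_of_real (h \<zeta>))" using h by simp
  have "(LINT \<zeta>|M. cnj \<zeta> ^ n) = (LINT \<zeta>|arc_measure. cnj \<zeta> ^ n * of_real (h \<zeta>))" for n
  proof -
    have "(if n = 0 then 1 else 2) * (LINT \<zeta>|M. cnj \<zeta> ^ n * 1)
        = (if n = 0 then 1 else 2) * (LINT \<zeta>|arc_measure. cnj \<zeta> ^ n * of_real (h \<zeta>))"
    proof (rule power_series_coefficients_unique)
      fix z :: complex assume z: "norm z < 1"
      show "(\<lambda>n. ((if n = 0 then 1 else 2) * (LINT \<zeta>|M. cnj \<zeta> ^ n * 1)) * z ^ n)
          sums (LINT \<zeta>|M. (\<zeta> + z) / (\<zeta> - z))"
        using herglotz_integral_sums[OF M one z] by (simp only: mult_1_right)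
      show "(\<lambda>n. ((if n = 0 then 1 else 2) * (LINT \<zeta>|arc_measure. cnj \<zeta> ^ n * of_real (h \<zeta>))) * z ^ n)
          sums (LINT \<zeta>|M. (\<zeta> + z) / (\<zeta> - z))"
        unfolding eq[OF z] by (rule herglotz_integral_sums[OF refl hc z])
    qed
    then show ?thesis by (simp split: if_splits)
  qed
  from equal_moments_singular_imp_null[OF M fin h this sing] show ?thesis .
qed

text \<open>This is the uniqueness of the canonical factorisation in the case that is needed. Let \<open>P\<close> be the Herglotz
integral of the singular measure and \<open>Q\<close> that of the logarithmic boundary modulus of \<open>F\<close>. Then
\<open>S * F\<close> is a constant times \<open>exp (Q - P)\<close>, so \<open>Q - P\<close> differs from \<open>g\<close> by a constant, and the Schwarz
formula writes \<open>Q - P\<close> as the Herglotz integral of a continuous density. Hence \<open>P\<close> is both the Herglotz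
integral of a singular measure and that of an integrable density, and the singular measure is zero.
The identity is only assumed away from 0, where a factor \<open>z ^ N\<close> can be cancelled.\<close>

lemma singular_factor_of_regular_function_trivial:
  assumes S: "singular_inner S" and F: "outer_function F"
    and cont: "continuous_on (cball 0 1) g" and hol: "g holomorphic_on ball 0 1"
    and eq: "\<And>z. norm z < 1 \<Longrightarrow> z \<noteq> 0 \<Longrightarrow> S z * F z = exp (g z)"
    and z: "norm z < 1"
  shows "S z = 1"
proof -
  obtain \<mu> where fin: "finite_measure \<mu>" and sing: "mutually_singular \<mu> arc_measure"
    and S\<mu>: "\<And>z. norm z < 1 \<Longrightarrow> S z = exp (- (LINT \<zeta>|\<mu>. (\<zeta> + z) / (\<zeta> - z)))"
    using S by (auto simp: singular_inner_def)
  obtain c \<psi> where c: "norm c = 1" and \<psi>: "integrable arc_measure (\<lambda>\<zeta>. ln (\<psi> \<zeta>))"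
    and F\<psi>: "\<And>z. norm z < 1 \<Longrightarrow>
      F z = c * exp (LINT \<zeta>|arc_measure. (\<zeta> + z) / (\<zeta> - z) * complex_of_real (ln (\<psi> \<zeta>)))"
    using F by (auto simp: outer_function_def)
  have M: "sets \<mu> = sets arc_measure" using sing by (simp add: mutually_singular_def)
  interpret \<mu>: finite_measure \<mu> by (rule fin)
  interpret A: prob_space arc_measure by (rule prob_space_arc_measure)
  have sp: "space \<mu> = sphere 0 1" using sets_eq_imp_space_eq[OF M] by simp
  have \<psi>c: "integrable arc_measure (\<lambda>\<zeta>. complex_of_real (ln (\<psi> \<zeta>)))" using \<psi> by simp
  define P where "P = (\<lambda>z. LINT \<zeta>|\<mu>. (\<zeta> + z) / (\<zeta> - z))"
  define Q where "Q = (\<lambda>z. LINT \<zeta>|arc_measure. (\<zeta> + z) / (\<zeta> - z) * complex_of_real (ln (\<psi> \<zeta>)))"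
  have "P holomorphic_on ball 0 1"
  proof (rule power_series_holomorphic)
    fix z :: complex assume "z \<in> ball 0 1"
    then have z: "norm z < 1" by simp
    have one: "integrable \<mu> (\<lambda>_. 1 :: complex)" by simp
    show "(\<lambda>n. ((if n = 0 then 1 else 2) * (LINT \<zeta>|\<mu>. cnj \<zeta> ^ n * 1)) * (z - 0) ^ n) sums P z"
      using herglotz_integral_sums[OF M one z] by (simp only: P_def mult_1_right diff_zero)
  qed
  moreover have "Q holomorphic_on ball 0 1"
  proof (rule power_series_holomorphic)
    fix z :: complex assume "z \<in> ball 0 1"
    then have z: "norm z < 1" by simp
    show "(\<lambda>n. ((if n = 0 then 1 else 2) * (LINT \<zeta>|arc_measure. cnj \<zeta> ^ n * of_real (ln (\<psi> \<zeta>))))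
        * (z - 0) ^ n) sums Q z"
      using herglotz_integral_sums[OF refl \<psi>c z] by (simp only: Q_def diff_zero)
  qed
  ultimately have holD: "(\<lambda>z. Q z - P z - g z) holomorphic_on ball 0 1"
    using hol by (intro holomorphic_intros)
  define D where "D = (\<lambda>z. Q z - P z - g z)"
  have expD: "exp (D z) = inverse c" if "norm z < 1" "z \<noteq> 0" for z
  proof -
    have "S z * F z = c * exp (Q z - P z)"
      unfolding S\<mu>[OF that(1)] F\<psi>[OF that(1)]
      by (simp add: P_def Q_def exp_diff exp_minus divide_inverse mult_ac)
    then have "c * exp (Q z - P z) = exp (g z)" using eq[OF that] by simp
    then have "c * exp (D z) = 1" unfolding D_def exp_diff[of _ "g z"] by simp
    then show ?thesis by (metis inverse_unique)
  qed
  have openD: "open (ball 0 1 - {0::complex})" by auto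
  \<comment> \<open>\<open>exp \<circ> D\<close> is constant on the punctured disk, so \<open>D\<close> has derivative zero there; the point 0 is
    covered by continuity.\<close>
  have D0: "DERIV D z :> 0" if z: "z \<in> ball 0 1 - {0}" for z
  proof -
    have "D field_differentiable at z"
      using holD z unfolding D_def by (intro holomorphic_on_imp_differentiable_at[of _ "ball 0 1"]) auto
    then obtain d where d: "DERIV D z :> d" by (auto simp: field_differentiable_def)
    then have "DERIV (\<lambda>z. exp (D z)) z :> exp (D z) * d"
      by (intro DERIV_chain2[of exp]) auto
    moreover have "DERIV (\<lambda>z. exp (D z)) z :> 0"
      by (rule has_field_derivative_transform_within_open[OF DERIV_const[of "inverse c"] openD z])
         (use expD in auto)
    ultimately have "exp (D z) * d = 0" by (rule DERIV_unique)
    then show ?thesis using d by simp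
  qed
  have "continuous_on (ball 0 1) D"
    using holD unfolding D_def by (rule holomorphic_on_imp_continuous_on)
  then obtain \<kappa> where \<kappa>: "\<And>z. z \<in> ball 0 1 \<Longrightarrow> D z = \<kappa>"
    using DERIV_zero_connected_constant[of "ball 0 1" "{0}" D] D0 by auto
  define G where "G = (\<lambda>z. g z + \<kappa>)"
  have G: "Q z - P z = G z" if "norm z < 1" for z
    using \<kappa>[of z] that by (simp add: G_def D_def algebra_simps)
  have "P 0 = (LINT \<zeta>|\<mu>. complex_of_real 1)"
    unfolding P_def by (rule Bochner_Integration.integral_cong) (auto simp: sp)
  moreover have "Q 0 = (LINT \<zeta>|arc_measure. complex_of_real (ln (\<psi> \<zeta>)))"
    unfolding Q_def by (rule Bochner_Integration.integral_cong) auto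
  ultimately have "Im (P 0) = 0" "Im (Q 0) = 0"
    unfolding integral_complex_of_real by simp_all
  \<comment> \<open>The additive imaginary constant in the Schwarz formula vanishes, since Herglotz integrals of
    real measures are real at 0.\<close>
  then have Im0: "Im (G 0) = 0" using G[of 0] by (metis diff_zero minus_complex.sel(2) norm_zero zero_less_one)
  have contG: "continuous_on (cball 0 1) G" and holG: "G holomorphic_on ball 0 1"
    unfolding G_def using cont hol by (auto intro!: continuous_intros holomorphic_intros)
  have ReG: "continuous_on (sphere 0 1) (\<lambda>\<zeta>. Re (G \<zeta>))"
    by (intro continuous_intros continuous_on_subset[OF contG]) auto
  have intG: "integrable arc_measure (\<lambda>\<zeta>. Re (G \<zeta>))"
    by (rule integrable_arc_continuous[OF ReG refl A.finite_measure_axioms])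
  have intGc: "integrable arc_measure (\<lambda>\<zeta>. complex_of_real (Re (G \<zeta>)))"
    using intG by simp
  have "space \<mu> \<in> null_sets \<mu>"
  proof (rule herglotz_unique_singular[OF sing fin])
    show "integrable arc_measure (\<lambda>\<zeta>. ln (\<psi> \<zeta>) - Re (G \<zeta>))" using \<psi> intG by simp
    fix z :: complex assume z: "norm z < 1"
    have ck: "continuous_on (sphere 0 1) (\<lambda>\<zeta>. (\<zeta> + z) / (\<zeta> - z))"
      using z by (intro continuous_intros) auto
    note int = integrable_arc_continuous_mult[OF ck refl \<psi>c] integrable_arc_continuous_mult[OF ck refl intGc]
    have "P z = Q z - G z" using G[OF z] by (simp add: algebra_simps)
    also have "G z = (LINT \<zeta>|arc_measure. (\<zeta> + z) / (\<zeta> - z) * of_real (Re (G \<zeta>)))"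
      using schwarz_formula[OF contG holG z] Im0 by simp
    also have "Q z - \<dots> = (LINT \<zeta>|arc_measure. (\<zeta> + z) / (\<zeta> - z) * of_real (ln (\<psi> \<zeta>) - Re (G \<zeta>)))"
      unfolding Q_def of_real_diff right_diff_distrib
      using int by (rule Bochner_Integration.integral_diff[symmetric])
    finally show "(LINT \<zeta>|\<mu>. (\<zeta> + z) / (\<zeta> - z))
      = (LINT \<zeta>|arc_measure. (\<zeta> + z) / (\<zeta> - z) * of_real (ln (\<psi> \<zeta>) - Re (G \<zeta>)))"
      unfolding P_def .
  qed
  then have "AE \<zeta> in \<mu>. \<zeta> \<notin> space \<mu>" by (rule AE_not_in)
  with AE_space have "AE \<zeta> in \<mu>. (\<zeta> + z) / (\<zeta> - z) = 0"
    by (rule AE_mp[OF _ AE_mp]) (rule AE_I2, blast)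
  then have "P z = 0" unfolding P_def by (rule integral_eq_zero_AE)
  then show ?thesis using S\<mu>[OF z] by (simp add: P_def)
qed

section \<open>Schur functions with coinciding kernel functions\<close>

text \<open>Clearing denominators in the equality of the two kernel functions leaves an equation that is affine
in \<open>\<phi> z\<close>, with coefficients affine in \<open>z\<close>; its right-hand side has the coefficient \<open>cnj b - cnj a \<noteq> 0\<close>.\<close>

lemma equal_kernel_functions_imp_moebius:
  assumes \<phi>: "\<phi> \<in> Schur_class" and ab: "a \<in> unit_disk" "b \<in> unit_disk" "a \<noteq> b"
    and eq: "\<And>z. z \<in> unit_disk \<Longrightarrow> (1 - cnj (\<phi> a) * \<phi> z) / (1 - cnj a * z) = (1 - cnj (\<phi> b) * \<phi> z) / (1 - cnj b * z)"
  obtains p q where "\<And>z. z \<in> unit_disk \<Longrightarrow> \<phi> z * (p + q * z) = z"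
proof
  define d where "d = cnj b - cnj a"
  have d: "d \<noteq> 0" using ab by (simp add: d_def)
  fix z :: complex assume z: "z \<in> unit_disk"
  have "1 - cnj a * z \<noteq> 0" "1 - cnj b * z \<noteq> 0"
    using one_minus_cnj_mult_nonzero[of _ z] ab z by auto
  then have "(1 - cnj (\<phi> a) * \<phi> z) * (1 - cnj b * z) = (1 - cnj (\<phi> b) * \<phi> z) * (1 - cnj a * z)"
    using eq[OF z] by (simp add: frac_eq_eq)
  then have 1: "\<phi> z * ((cnj (\<phi> b) - cnj (\<phi> a)) + (cnj (\<phi> a) * cnj b - cnj (\<phi> b) * cnj a) * z) = d * z"
    by (simp add: d_def algebra_simps)
  have "\<phi> z * (u / d + v / d * z) = \<phi> z * (u + v * z) / d" for u v
    by (simp add: add_divide_distrib distrib_left)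
  then show "\<phi> z * ((cnj (\<phi> b) - cnj (\<phi> a)) / d + (cnj (\<phi> a) * cnj b - cnj (\<phi> b) * cnj a) / d * z) = z"
    using 1 d by simp
qed

text \<open>The bound \<open>norm (\<phi> z) \<le> 1\<close> gives \<open>norm z \<le> norm (p + q * z)\<close> on the disk. A zero \<open>z0\<close> of \<open>p + q * z\<close> in
the closed disk would be nonzero, and letting \<open>z\<close> tend to \<open>z0\<close> along the radius would give \<open>norm z0 \<le> 0\<close>.\<close>

lemma moebius_pole_outside_closed_disk:
  assumes \<phi>: "\<phi> \<in> Schur_class" and eq: "\<And>z. z \<in> unit_disk \<Longrightarrow> \<phi> z * (p + q * z) = z" and p: "p \<noteq> 0"
  shows "norm q < norm p"
proof (rule ccontr)
  assume "\<not> norm q < norm p"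
  then have q: "norm p \<le> norm q" "q \<noteq> 0" using p by auto
  define z0 where "z0 = - p / q"
  have z0: "norm z0 \<le> 1" "z0 \<noteq> 0" using q p by (auto simp: z0_def norm_divide)
  have pz: "p + q * z0 = 0" using q by (simp add: z0_def)
  define r where "r = (\<lambda>n. 1 - inverse (real (Suc n)))"
  have "r \<longlonglongrightarrow> 1 - 0" unfolding r_def by (intro tendsto_intros LIMSEQ_inverse_real_of_nat)
  then have r1: "r \<longlonglongrightarrow> 1" by simp
  have le: "r n * norm z0 \<le> norm p * (1 - r n)" for n
  proof -
    have r: "0 \<le> r n" "r n < 1" by (auto simp: r_def field_simps)
    define z where "z = of_real (r n) * z0"
    have nz: "norm z = r n * norm z0" using r by (simp add: z_def norm_mult)
    have "r n * norm z0 \<le> r n * 1" using r z0 by (intro mult_left_mono) auto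
    then have z: "z \<in> unit_disk" using nz r by simp
    have "norm z = norm (\<phi> z) * norm (p + q * z)" using eq[OF z] by (metis norm_mult)
    also have "\<dots> \<le> 1 * norm (p + q * z)"
      using \<phi> z by (intro mult_right_mono) (auto simp: Schur_class_def)
    also have "p + q * z = p * of_real (1 - r n)"
      using pz by (simp add: z_def algebra_simps) (metis add_eq_0_iff2 mult_minus_right mult.left_commute mult.commute)
    also have "1 * norm (p * of_real (1 - r n)) = norm p * (1 - r n)"
      using r(2) unfolding norm_mult norm_of_real by simp
    finally show ?thesis using nz by simp
  qed
  have "1 * norm z0 \<le> norm p * (1 - 1)"
  proof (rule LIMSEQ_le)
    show "(\<lambda>n. r n * norm z0) \<longlonglongrightarrow> 1 * norm z0" by (intro tendsto_intros r1)
    show "(\<lambda>n. norm p * (1 - r n)) \<longlonglongrightarrow> norm p * (1 - 1)" by (intro tendsto_intros r1)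
  qed (use le in blast)
  then show False using z0 by simp
qed

lemma blaschke_product_zero_free:
  assumes B: "is_blaschke_product_of \<phi> B" and "\<And>a. a \<in> unit_disk \<Longrightarrow> a \<noteq> 0 \<Longrightarrow> \<phi> a \<noteq> 0"
    and z: "z \<in> unit_disk"
  shows "B z = 1"
proof -
  have no: "{a \<in> unit_disk. a \<noteq> 0 \<and> \<phi> a = 0} = {}" using assms(2) by blast
  have "((\<lambda>A. \<Prod>a\<in>A. blaschke_factor a z ^ nat (zorder \<phi> a)) \<longlongrightarrow> B z) (finite_subsets_at_top {})"
    using B z unfolding is_blaschke_product_of_def no by blast
  then have "((\<lambda>A. \<Prod>a\<in>A. blaschke_factor a z ^ nat (zorder \<phi> a)) \<longlongrightarrow> B z) (principal {{}})"
    by (simp only: finite_subsets_at_top_finite[OF finite.emptyI])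
  moreover have "((\<lambda>A. \<Prod>a\<in>A. blaschke_factor a z ^ nat (zorder \<phi> a)) \<longlongrightarrow> 1) (principal {{}})"
    by (rule tendsto_eventually) (simp add: eventually_principal)
  ultimately show ?thesis
    by (rule tendsto_unique[rotated]) (simp add: principal_eq_bot_iff)
qed

text \<open>Such a \<open>\<phi>\<close> has no zero off 0, so its Blaschke product is empty, and \<open>S * F\<close> is a constant multiple
of \<open>1 / (p + q * z)\<close>. This function has a logarithm that is holomorphic across the circle, because
\<open>p + q * z\<close> has no zero in the closed disk.\<close>

lemma power_over_linear_factorization_trivial:
  assumes fact: "canonical_factorization \<phi> \<alpha> N B S F"
    and \<phi>: "\<And>z. z \<in> unit_disk \<Longrightarrow> z \<noteq> 0 \<Longrightarrow> \<phi> z = z ^ m / (p + q * z)"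
    and pq: "norm q < norm p"
  shows "N = m" "\<And>a. a \<in> unit_disk - {0} \<Longrightarrow> \<phi> a \<noteq> 0" "S constant_on unit_disk"
proof -
  have p0: "p \<noteq> 0" using pq by auto
  define w where "w = q / p"
  have w: "norm w < 1" using pq p0 by (simp add: w_def norm_divide)
  have fac: "p + q * z = p * (1 + w * z)" for z using p0 by (simp add: w_def algebra_simps)
  have wz: "norm (w * z) < 1" if "norm z \<le> 1" for z
  proof -
    have "norm (w * z) \<le> norm w * 1" unfolding norm_mult using that by (intro mult_left_mono) auto
    then show ?thesis using w by simp
  qed
  have Re: "0 < Re (1 + w * z)" if "norm z \<le> 1" for z
    using wz[OF that] abs_Re_le_cmod[of "w * z"] by (simp only: plus_complex.sel one_complex.sel)
  have ne: "1 + w * z \<noteq> 0" if "norm z \<le> 1" for z using Re[OF that] by (metis less_irrefl zero_complex.sel(1))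
  have pole: "p + q * z \<noteq> 0" if "norm z \<le> 1" for z using ne[OF that] p0 by (simp add: fac)
  have "zorder \<phi> 0 = int m"
  proof (rule zorder_eqI[of unit_disk 0 "\<lambda>z. 1 / (p + q * z)"])
    show "(\<lambda>z. 1 / (p + q * z)) holomorphic_on unit_disk"
      using pole by (intro holomorphic_intros) auto
    show "\<phi> z = 1 / (p + q * z) * (z - 0) powi int m" if "z \<in> unit_disk" "z \<noteq> 0" for z
      using \<phi>[OF that] by simp
  qed (use p0 in auto)
  then show N: "N = m" using fact by (simp add: canonical_factorization_def)
  show nz: "\<phi> a \<noteq> 0" if "a \<in> unit_disk - {0}" for a
    using \<phi>[of a] pole[of a] that by simp
  \<comment> \<open>The second term is holomorphic because \<open>1 + w * z\<close> stays in the right half-plane; in the constant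
    term every branch of the logarithm would serve.\<close>
  define g where "g = (\<lambda>z. - Ln (\<alpha> * p) - Ln (1 + w * z))"
  have \<alpha>: "\<alpha> \<noteq> 0" using fact by (auto simp: canonical_factorization_def)
  have notneg: "1 + w * z \<notin> \<real>\<^sub>\<le>\<^sub>0" if "norm z \<le> 1" for z
    using Re[OF that] by (auto simp: complex_nonpos_Reals_iff)
  have "g holomorphic_on cball 0 1"
    unfolding g_def using notneg by (intro holomorphic_intros) auto
  then have holg: "continuous_on (cball 0 1) g" "g holomorphic_on ball 0 1"
    by (auto intro: holomorphic_on_imp_continuous_on holomorphic_on_subset)
  have S: "singular_inner S" and F: "outer_function F" and B: "is_blaschke_product_of \<phi> B"
    and f: "\<And>z. z \<in> unit_disk \<Longrightarrow> \<phi> z = \<alpha> * z ^ N * B z * S z * F z"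
    using fact by (auto simp: canonical_factorization_def)
  have "S z = 1" if "norm z < 1" for z
  proof (rule singular_factor_of_regular_function_trivial[OF S F holg _ that])
    fix z :: complex assume z: "norm z < 1" "z \<noteq> 0"
    have "B z = 1" by (rule blaschke_product_zero_free[OF B]) (use nz z in auto)
    then have "z ^ m / (p + q * z) = z ^ m * (\<alpha> * (S z * F z))"
      using f[of z] \<phi>[of z] z N by (simp add: mult_ac)
    then have "z ^ m * (1 / (p + q * z)) = z ^ m * (\<alpha> * (S z * F z))" by simp
    then have SF: "1 / (p + q * z) = \<alpha> * (S z * F z)"
      by (rule mult_left_cancel[THEN iffD1, rotated]) (use z in simp)
    have "exp (g z) = 1 / (p + q * z) / \<alpha>"
      using \<alpha> p0 ne[of z] z by (simp add: g_def exp_diff exp_minus fac divide_inverse mult_ac)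
    then show "S z * F z = exp (g z)" unfolding SF using \<alpha> by simp
  qed
  then show "S constant_on unit_disk" unfolding constant_on_def by auto
qed

theorem theorem4p2:
  fixes \<phi> B S F :: "complex \<Rightarrow> complex" and \<alpha> :: complex and N :: nat
  assumes "\<phi> \<in> Schur_class"
    and "\<exists>z\<in>unit_disk. \<phi> z \<noteq> 0"
    and "canonical_factorization \<phi> \<alpha> N B S F"
    and "N \<ge> 2 \<or> (\<exists>a\<in>unit_disk - {0}. \<phi> a = 0) \<or> \<not> S constant_on unit_disk"
  shows "\<forall>t::real. t > 0 \<longrightarrow>
    strictly_positive_definite_on unit_disk
      (\<lambda>z l. exp (of_real t * ((1 - cnj (\<phi> l) * \<phi> z) / (1 - cnj l * z))))"
proof -
  have sep: "\<exists>z\<in>unit_disk. (1 - cnj (\<phi> a) * \<phi> z) / (1 - cnj a * z) \<noteq> (1 - cnj (\<phi> b) * \<phi> z) / (1 - cnj b * z)"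
    if ab: "a \<in> unit_disk" "b \<in> unit_disk" "a \<noteq> b" for a b
  proof (rule ccontr)
    assume "\<not> ?thesis"
    then have "(1 - cnj (\<phi> a) * \<phi> z) / (1 - cnj a * z) = (1 - cnj (\<phi> b) * \<phi> z) / (1 - cnj b * z)"
      if "z \<in> unit_disk" for z using that by blast
    from equal_kernel_functions_imp_moebius[OF assms(1) ab this]
    obtain p q where pq: "\<And>z. z \<in> unit_disk \<Longrightarrow> \<phi> z * (p + q * z) = z" by blast
    \<comment> \<open>If \<open>p = 0\<close>, then \<open>\<phi>\<close> is constant off 0, which is the case \<open>m = 0\<close>; otherwise \<open>\<phi>\<close> has a simple zero at 0.\<close>
    obtain m p' q' where m: "m \<le> 1" and pq': "norm q' < norm p'"
      and \<phi>: "\<And>z. z \<in> unit_disk \<Longrightarrow> z \<noteq> 0 \<Longrightarrow> \<phi> z = z ^ m / (p' + q' * z)"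
    proof (cases "p = 0")
      case True
      then have 1: "\<phi> z * q = 1" if "z \<in> unit_disk" "z \<noteq> 0" for z
        using pq[OF that(1)] that(2) by simp
      have "q \<noteq> 0" using 1[of "1/2"] by auto
      with 1 show thesis by (intro that[of 0 0 q]) (auto simp: field_simps)
    next
      case False
      have "\<phi> z = z / (p + q * z)" if "z \<in> unit_disk" "z \<noteq> 0" for z
      proof -
        have "p + q * z \<noteq> 0" using pq[OF that(1)] that(2) by auto
        then show ?thesis using pq[OF that(1)] by (rule eq_divide_imp)
      qed
      with moebius_pole_outside_closed_disk[OF assms(1) pq False] show thesis
        by (intro that[of 1 q p]) auto
    qed
    note triv = power_over_linear_factorization_trivial[OF assms(3) \<phi> pq']
    show False using assms(4) m triv by auto
  qed
  show ?thesis
    using exp_kernel_strictly_positive_definite[OF de_branges_rovnyak_kernel_psd[OF assms(1)] sep] by blast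
qed

end
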